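(* Let $\mathcal{H}$ be a Hilbert space, $\Omega\in\mathcal{H}$ a unit vector, and let $X,Y$ be two positive bounded operators on $\mathcal{H}$ such that $X-\mathbf{1}$ and $Y$ are monotonically independent with respect to $\Omega$. Then \[ K_{\sqrt{X}Y\sqrt{X}}(z)=K_X\big(K_Y(z)\big) \] for all $z\in\mathbb{C}$ with $|z|<\min\big(1/\|\sqrt{X}Y\sqrt{X}\|,\,1/\|Y\|\big)$, where the right-hand side, which is defined and holomorphic in a neighbourhood of $0$, is understood on this disc by meromorphic continuation from a neighbourhood of $0$.
   Context: $\mathcal{B}(\mathcal{H})$ is the algebra of bounded operators on $\mathcal{H}$ with identity $\mathbf{1}$. Put $\Phi(X)=\langle\Omega,X\Omega\rangle$ for $X\in\mathcal{B}(\mathcal{H})$. Two (not necessarily unital) subalgebras $\mathcal{A}_1,\mathcal{A}_2\subseteq\mathcal{B}(\mathcal{H})$ (in this order) are called monotonically independent with respect to $\Omega$ if (a) $XYZ=\Phi(Y)XZ$ for all $X,Z\in\mathcal{A}_1$, $Y\in\mathcal{A}_2$; and (b) $\Phi(XYZ)=\Phi(X)\Phi(Y)\Phi(Z)$ for all $Y\in\mathcal{A}_1$ and $X,Z\in\mathcal{A}_2\cup\{\mathbf{1}\}$. Two operators $X,Y\in\mathcal{B}(\mathcal{H})$ (in this order) are called monotonically independent with respect to $\Omega$ if the subalgebras $\mathrm{alg}(X)=\mathrm{span}\{X^k: k=1,2,\ldots\}$ and $\mathrm{alg}(Y)=\mathrm{span}\{Y^k:k=1,2,\ldots\}$ are monotonically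 independent. For a bounded operator $X\in\mathcal{B}(\mathcal{H})$ and $|z|<1/\|X\|$ (with $1/0=\infty$) define \[ \psi_X(z)=\left\langle\Omega,\,zX(\mathbf{1}-zX)^{-1}\Omega\right\rangle,\qquad K_X(z)=\frac{\psi_X(z)}{1+\psi_X(z)}. \] Thus $\psi_X$ is holomorphic and $K_X$ is meromorphic on the disc $|z|<1/\|X\|$, $K_X$ is holomorphic near $0$, and $K_X(0)=0$. *)

theory Defs
  imports "HOL-Complex_Analysis.Complex_Analysis"
begin

section \<open>Complex Hilbert spaces\<close>

class complex_vector = real_vector +
  fixes scaleC :: "complex \<Rightarrow> 'a \<Rightarrow> 'a" (infixr "*\<^sub>C" 75)
  assumes scaleC_add_right: "a *\<^sub>C (x + y) = a *\<^sub>C x + a *\<^sub>C y"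
    and scaleC_add_left: "(a + b) *\<^sub>C x = a *\<^sub>C x + b *\<^sub>C x"
    and scaleC_scaleC: "a *\<^sub>C (b *\<^sub>C x) = (a * b) *\<^sub>C x"
    and scaleR_scaleC: "r *\<^sub>R x = complex_of_real r *\<^sub>C x"

global_interpretation complex_vector:
  vector_space "scaleC :: complex \<Rightarrow> 'a \<Rightarrow> 'a :: complex_vector"
  defines cspan = "module.span (scaleC :: complex \<Rightarrow> 'a \<Rightarrow> 'a :: complex_vector)"
    and csubspace = "module.subspace (scaleC :: complex \<Rightarrow> 'a \<Rightarrow> 'a :: complex_vector)"
proof
  show "1 *\<^sub>C x = x" for x :: 'a
    using scaleR_scaleC[of 1 x] by simp
qed (simp_all add: scaleC_add_right scaleC_add_left scaleC_scaleC)

text \<open>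
  The inner product is antilinear in the first and linear in the second argument. Since
  \<^term>\<open>norm x\<close> is nonnegative and vanishes only at \<^term>\<open>0\<close>, the last axiom also expresses
  positive definiteness. Completeness comes from \<^class>\<open>banach\<close>.
\<close>

class complex_hilbert_space = complex_vector + banach +
  fixes cinner :: "'a \<Rightarrow> 'a \<Rightarrow> complex"
  assumes cinner_commute: "cinner x y = cnj (cinner y x)"
    and cinner_add_right: "cinner x (y + z) = cinner x y + cinner x z"
    and cinner_scaleC_right: "cinner x (c *\<^sub>C y) = c * cinner x y"
    and norm_eq_sqrt_cinner: "norm x = sqrt (Re (cinner x x))"

lemma cinner_scaleC_left: "cinner (c *\<^sub>C x) y = cnj c * cinner x y"
  for x :: "'a :: complex_hilbert_space"
  by (metis cinner_commute cinner_scaleC_right complex_cnj_mult)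

lemma norm_scaleC: "norm (c *\<^sub>C x) = cmod c * norm x"
  for x :: "'a :: complex_hilbert_space"
proof -
  have "cinner (c *\<^sub>C x) (c *\<^sub>C x) = complex_of_real ((cmod c)\<^sup>2) * cinner x x"
    by (simp add: cinner_scaleC_left cinner_scaleC_right complex_norm_square[of c]
        del: of_real_power)
  then show ?thesis
    by (simp add: norm_eq_sqrt_cinner real_sqrt_mult)
qed

lemma bounded_linear_scaleC: "bounded_linear (\<lambda>x :: 'a :: complex_hilbert_space. c *\<^sub>C x)"
  for c :: complex
proof (rule bounded_linear_intro[where K = "cmod c"])
  show "c *\<^sub>C (x + y) = c *\<^sub>C x + c *\<^sub>C y" for x y :: 'a
    by (rule scaleC_add_right)
  show "c *\<^sub>C (r *\<^sub>R x) = r *\<^sub>R (c *\<^sub>C x)" for r and x :: 'a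
    by (simp add: scaleR_scaleC scaleC_scaleC mult.commute)
  show "norm (c *\<^sub>C x) \<le> norm x * cmod c" for x :: 'a
    by (simp add: norm_scaleC)
qed


section \<open>Bounded operators\<close>

text \<open>
  Elements of \<^typ>\<open>'a \<Rightarrow>\<^sub>L 'a\<close> are bounded \<^emph>\<open>real\<close>-linear maps with the operator norm; the
  algebra of bounded (complex-linear) operators is the subset \<open>bounded_operators\<close> below.
\<close>

instantiation blinfun :: (complex_hilbert_space, complex_hilbert_space) complex_vector
begin

lift_definition scaleC_blinfun :: "complex \<Rightarrow> ('a \<Rightarrow>\<^sub>L 'b) \<Rightarrow> 'a \<Rightarrow>\<^sub>L 'b"
  is "\<lambda>c T x. c *\<^sub>C T x"
  by (rule bounded_linear_compose[OF bounded_linear_scaleC])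

instance
  by standard
    (transfer, simp add: scaleC_add_right scaleC_add_left scaleC_scaleC scaleR_scaleC fun_eq_iff)+

end

definition bounded_operators :: "('a :: complex_hilbert_space \<Rightarrow>\<^sub>L 'a) set" where
  "bounded_operators = {T. \<forall>c x. blinfun_apply T (c *\<^sub>C x) = c *\<^sub>C blinfun_apply T x}"

definition op_power :: "('a :: complex_hilbert_space \<Rightarrow>\<^sub>L 'a) \<Rightarrow> nat \<Rightarrow> 'a \<Rightarrow>\<^sub>L 'a" where
  "op_power T k = (((o\<^sub>L) T) ^^ k) id_blinfun"

definition op_inverse :: "('a :: complex_hilbert_space \<Rightarrow>\<^sub>L 'a) \<Rightarrow> 'a \<Rightarrow>\<^sub>L 'a" where
  "op_inverse T = (THE S. S o\<^sub>L T = id_blinfun \<and> T o\<^sub>L S = id_blinfun)"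

definition positive_operator :: "('a :: complex_hilbert_space \<Rightarrow>\<^sub>L 'a) \<Rightarrow> bool" where
  "positive_operator T \<longleftrightarrow>
     T \<in> bounded_operators \<and> (\<forall>x. cinner x (blinfun_apply T x) \<in> \<real>\<^sub>\<ge>\<^sub>0)"

definition op_sqrt :: "('a :: complex_hilbert_space \<Rightarrow>\<^sub>L 'a) \<Rightarrow> 'a \<Rightarrow>\<^sub>L 'a" where
  "op_sqrt T = (THE S. positive_operator S \<and> S o\<^sub>L S = T)"


section \<open>Monotone independence\<close>

definition vector_state ::
    "'a :: complex_hilbert_space \<Rightarrow> ('a \<Rightarrow>\<^sub>L 'a) \<Rightarrow> complex" where
  "vector_state \<Omega> T = cinner \<Omega> (blinfun_apply T \<Omega>)"

definition is_subalgebra :: "('a :: complex_hilbert_space \<Rightarrow>\<^sub>L 'a) set \<Rightarrow> bool" where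
  "is_subalgebra A \<longleftrightarrow>
     A \<subseteq> bounded_operators \<and> csubspace A \<and> (\<forall>S\<in>A. \<forall>T\<in>A. S o\<^sub>L T \<in> A)"

definition monotone_independent_algebras ::
    "'a :: complex_hilbert_space \<Rightarrow> ('a \<Rightarrow>\<^sub>L 'a) set \<Rightarrow> ('a \<Rightarrow>\<^sub>L 'a) set \<Rightarrow> bool" where
  "monotone_independent_algebras \<Omega> A\<^sub>1 A\<^sub>2 \<longleftrightarrow>
     is_subalgebra A\<^sub>1 \<and> is_subalgebra A\<^sub>2 \<and>
     (\<forall>X\<in>A\<^sub>1. \<forall>Z\<in>A\<^sub>1. \<forall>Y\<in>A\<^sub>2.
        X o\<^sub>L Y o\<^sub>L Z = vector_state \<Omega> Y *\<^sub>C (X o\<^sub>L Z)) \<and>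
     (\<forall>Y\<in>A\<^sub>1. \<forall>X\<in>A\<^sub>2 \<union> {id_blinfun}. \<forall>Z\<in>A\<^sub>2 \<union> {id_blinfun}.
        vector_state \<Omega> (X o\<^sub>L Y o\<^sub>L Z) =
          vector_state \<Omega> X * vector_state \<Omega> Y * vector_state \<Omega> Z)"

definition op_alg :: "('a :: complex_hilbert_space \<Rightarrow>\<^sub>L 'a) \<Rightarrow> ('a \<Rightarrow>\<^sub>L 'a) set" where
  "op_alg X = cspan {op_power X k | k. k \<ge> 1}"

definition monotone_independent ::
    "'a :: complex_hilbert_space \<Rightarrow> ('a \<Rightarrow>\<^sub>L 'a) \<Rightarrow> ('a \<Rightarrow>\<^sub>L 'a) \<Rightarrow> bool" where
  "monotone_independent \<Omega> X Y \<longleftrightarrow>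
     monotone_independent_algebras \<Omega> (op_alg X) (op_alg Y)"

text \<open>
  The subalgebra conditions in the definition of monotone independence hold automatically for
  the algebras generated by bounded operators.
\<close>

lemma is_subalgebra_op_alg:
  assumes "X \<in> bounded_operators"
  shows "is_subalgebra (op_alg X)"
proof -
  have scale_left: "(c *\<^sub>C S) o\<^sub>L T = c *\<^sub>C (S o\<^sub>L T)" for c and S T :: "'a \<Rightarrow>\<^sub>L 'a"
    by (rule blinfun_eqI) (simp add: scaleC_blinfun.rep_eq)
  have scale_right: "S o\<^sub>L (c *\<^sub>C T) = c *\<^sub>C (S o\<^sub>L T)"
    if "S \<in> bounded_operators" for c and S T :: "'a \<Rightarrow>\<^sub>L 'a"
    using that by (intro blinfun_eqI) (simp add: scaleC_blinfun.rep_eq bounded_operators_def)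
  have add_left: "(S + S') o\<^sub>L T = (S o\<^sub>L T) + (S' o\<^sub>L T)" for S S' T :: "'a \<Rightarrow>\<^sub>L 'a"
    by (rule blinfun_eqI) (simp add: blinfun.add_left)
  have add_right: "S o\<^sub>L (T + T') = (S o\<^sub>L T) + (S o\<^sub>L T')" for S T T' :: "'a \<Rightarrow>\<^sub>L 'a"
    by (rule blinfun_eqI) (simp add: blinfun.add_left blinfun.add_right)
  have pow_add: "op_power X k o\<^sub>L op_power X l = op_power X (k + l)" for k l
  proof (induction k)
    case 0
    show ?case
      by (auto simp: op_power_def intro!: blinfun_eqI)
  next
    case (Suc k)
    have "op_power X (Suc k) o\<^sub>L op_power X l = X o\<^sub>L (op_power X k o\<^sub>L op_power X l)"
      by (auto simp: op_power_def intro!: blinfun_eqI)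
    then show ?case
      by (simp add: Suc) (simp add: op_power_def)
  qed
  have pow: "op_power X k \<in> bounded_operators" for k
    using assms by (induction k) (auto simp: op_power_def bounded_operators_def)
  have sub: "csubspace (bounded_operators :: ('a \<Rightarrow>\<^sub>L 'a) set)"
    by (auto simp: complex_vector.subspace_def bounded_operators_def blinfun.add_left
        scaleC_blinfun.rep_eq scaleC_add_right scaleC_scaleC mult.commute)
  have bdd: "op_alg X \<subseteq> bounded_operators"
    unfolding op_alg_def by (rule complex_vector.span_minimal) (use pow sub in auto)
  have csub: "csubspace (op_alg X)"
    unfolding op_alg_def by (rule complex_vector.subspace_span)
  have power_mult: "op_power X k o\<^sub>L T \<in> op_alg X" if "k \<ge> 1" "T \<in> op_alg X" for k T
    using that(2) unfolding op_alg_def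
  proof (induction rule: complex_vector.span_induct)
    case base
    then show ?case
      using complex_vector.subspace_0[OF csub]
        complex_vector.subspace_add[OF csub] complex_vector.subspace_scale[OF csub]
      by (auto simp: complex_vector.subspace_def op_alg_def add_right scale_right[OF pow])
  next
    case (step T)
    then obtain l where l: "T = op_power X l" "l \<ge> 1" by auto
    have "op_power X (k + l) \<in> {op_power X k | k. k \<ge> 1}"
      using \<open>l \<ge> 1\<close> by (auto intro!: exI[of _ "k + l"])
    then show ?case
      unfolding l pow_add by (rule complex_vector.span_base)
  qed
  have "S o\<^sub>L T \<in> op_alg X" if "S \<in> op_alg X" and T: "T \<in> op_alg X" for S T
    using that(1) unfolding op_alg_def
  proof (induction rule: complex_vector.span_induct)
    case base
    then show ?case
      using complex_vector.subspace_0[OF csub]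
        complex_vector.subspace_add[OF csub] complex_vector.subspace_scale[OF csub]
      by (auto simp: complex_vector.subspace_def op_alg_def add_left scale_left)
  next
    case (step S)
    then show ?case
      using power_mult[OF _ T] by (auto simp: op_alg_def)
  qed
  with bdd csub show ?thesis
    by (simp add: is_subalgebra_def)
qed


section \<open>The transforms and meromorphic continuation\<close>

definition psi_transform ::
    "'a :: complex_hilbert_space \<Rightarrow> ('a \<Rightarrow>\<^sub>L 'a) \<Rightarrow> complex \<Rightarrow> complex" where
  "psi_transform \<Omega> X z =
     cinner \<Omega> (blinfun_apply ((z *\<^sub>C X) o\<^sub>L op_inverse (id_blinfun - z *\<^sub>C X)) \<Omega>)"

text \<open>
  Poles of the meromorphic function below are the points with \<open>\<psi> = -1\<close>; there the convention
  \<open>x / 0 = 0\<close> yields the value \<open>0\<close>, which is also the value that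
  \<^const>\<open>nicely_meromorphic_on\<close> prescribes at poles.
\<close>

definition K_transform ::
    "'a :: complex_hilbert_space \<Rightarrow> ('a \<Rightarrow>\<^sub>L 'a) \<Rightarrow> complex \<Rightarrow> complex" where
  "K_transform \<Omega> X z = psi_transform \<Omega> X z / (1 + psi_transform \<Omega> X z)"

text \<open>In \<^typ>\<open>ereal\<close> one has \<open>1 / 0 = \<infinity>\<close>.\<close>

definition transform_disc :: "('a :: complex_hilbert_space \<Rightarrow>\<^sub>L 'a) \<Rightarrow> complex set" where
  "transform_disc X = {z. ereal (cmod z) < 1 / ereal (norm X)}"

text \<open>
  \<open>g\<close> is a meromorphic continuation to \<open>D\<close> of the germ of \<open>f\<close> at \<open>0\<close>. Because \<open>g\<close> is required
  to be nicely meromorphic, its values on \<open>D\<close> determine its poles, so that pointwise equality of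
  two such functions on an open \<open>D\<close> is equality as meromorphic functions.
\<close>

definition meromorphic_continuation_from_0 ::
    "(complex \<Rightarrow> complex) \<Rightarrow> complex set \<Rightarrow> (complex \<Rightarrow> complex) \<Rightarrow> bool" where
  "meromorphic_continuation_from_0 f D g \<longleftrightarrow>
     g nicely_meromorphic_on D \<and> (\<forall>\<^sub>F z in nhds 0. g z = f z)"

end

theory Submission
  imports Defs
begin

text \<open>
  Put \<open>A = \<surd>X\<close>, \<open>U = X - 1\<close>, \<open>B = A - 1\<close>, \<open>S = A Y A\<close> and \<open>H = zY(1 - zY)\<^sup>-\<^sup>1\<close>, so that
  \<open>h = \<Phi>(H) = \<psi>\<^sub>Y(z)\<close> and \<open>K\<^sub>Y(z) = h / (1 + h)\<close>. The square root is a norm limit of polynomials in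
  \<open>U\<close>, hence \<open>B\<close> lies in the norm closure of \<open>alg(U)\<close>, and the two factorisation rules of monotone
  independence persist on closures. In particular \<open>U H U = h U\<^sup>2\<close>, and with \<open>V = (1 - hU)\<^sup>-\<^sup>1\<close> this gives
  \<open>(1 - zS)\<^sup>-\<^sup>1 = 1 + A (H + H U V H) A\<close>. Expanding \<open>A = 1 + B\<close>, the rules yield
  \<open>1 + \<psi>\<^sub>S(z) = 1 + h \<Phi>(X) + h\<^sup>2 \<Phi>(X U V) = 1 + h \<Phi>(X V) = (1 + h) \<Phi>(V)\<close>, and the right-hand side is
  \<open>1 + \<psi>\<^sub>X(K\<^sub>Y(z))\<close> because \<open>1 - K\<^sub>Y(z) X = (1 - hU) / (1 + h)\<close>. This settles the identity near \<open>0\<close>;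
  on the whole disc it is the identity theorem for meromorphic functions.
\<close>

section \<open>Nicely meromorphic functions\<close>

text \<open>On a connected open set the meromorphic difference either vanishes or avoids zero off a
  sparse set, and agreement near \<open>z0\<close> excludes the second case. The normalisation in
  nice meromorphy then upgrades agreement off a sparse set to agreement at every point, poles
  included.\<close>

lemma nicely_meromorphic_on_eqI:
  assumes "f nicely_meromorphic_on D" "g nicely_meromorphic_on D" "open D" "connected D"
    and "z0 \<in> D" "\<forall>\<^sub>F z in nhds z0. f z = g z" "z \<in> D"
  shows "f z = g z"
proof -
  have mero: "(\<lambda>z. f z - g z) meromorphic_on D"
    using assms(1,2) by (auto simp: nicely_meromorphic_on_def intro!: meromorphic_intros)
  have "\<not> (\<forall>\<^sub>\<approx>z\<in>D. f z - g z \<noteq> 0)"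
  proof
    assume "\<forall>\<^sub>\<approx>z\<in>D. f z - g z \<noteq> 0"
    then have "\<forall>\<^sub>F z in at z0. f z - g z \<noteq> 0"
      using assms(3,5) by (simp add: eventually_cosparse_open_eq)
    moreover have "\<forall>\<^sub>F z in at z0. f z = g z"
      using assms(6) by (auto simp: eventually_at_filter elim: eventually_mono)
    ultimately have "\<forall>\<^sub>F z in at z0. False"
      by eventually_elim simp
    then show False
      by simp
  qed
  then have "\<forall>\<^sub>\<approx>z\<in>D. f z - g z = 0"
    using meromorphic_imp_constant_or_avoid[OF mero assms(3,4), of 0] by blast
  then have ev: "\<forall>\<^sub>F w in at z. f w = g w"
    using assms(3,7) by (simp add: eventually_cosparse_open_eq)
  have pole: "is_pole f z \<longleftrightarrow> is_pole g z"
    by (rule is_pole_cong[OF ev refl])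
  have lim: "f \<midarrow>z\<rightarrow> l \<longleftrightarrow> g \<midarrow>z\<rightarrow> l" for l
    by (rule filterlim_cong[OF refl refl ev])
  show ?thesis
  proof (cases "is_pole f z")
    case True
    \<comment> \<open>At a pole no finite limit exists, so nice meromorphy leaves only the
      prescribed value 0.\<close>
    have "f z = 0"
      using True assms(1,7) not_tendsto_and_filterlim_at_infinity[OF at_neq_bot]
      by (auto simp: nicely_meromorphic_on_def is_pole_def)
    moreover have "g z = 0"
      using True pole assms(2,7) not_tendsto_and_filterlim_at_infinity[OF at_neq_bot]
      by (auto simp: nicely_meromorphic_on_def is_pole_def)
    ultimately show ?thesis
      by simp
  next
    case False
    then have "f \<midarrow>z\<rightarrow> f z" "g \<midarrow>z\<rightarrow> g z"
      using pole assms(1,2,7) by (auto simp: nicely_meromorphic_on_def)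
    then show ?thesis
      unfolding lim by (rule tendsto_unique[OF at_neq_bot])
  qed
qed

text \<open>The point \<open>z0\<close> makes the zeros of \<open>1 + f\<close> isolated. At such a
  zero the numerator is -1, so the quotient has a genuine pole, and division by zero returns exactly
  the value 0 required there.\<close>

lemma nicely_meromorphic_on_divide_one_plus:
  fixes f :: "complex \<Rightarrow> complex"
  assumes f: "f holomorphic_on D" and D: "open D" "connected D"
    and z0: "z0 \<in> D" "1 + f z0 \<noteq> 0"
  shows "(\<lambda>z. f z / (1 + f z)) nicely_meromorphic_on D"
  unfolding nicely_meromorphic_on_def
proof (intro conjI ballI)
  have an: "f analytic_on D"
    using f D by (simp add: analytic_on_open)
  show "(\<lambda>z. f z / (1 + f z)) meromorphic_on D"
    by (intro meromorphic_intros analytic_on_imp_meromorphic_on an)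
  fix z assume z: "z \<in> D"
  have cont: "isCont f z"
    using f D z by (meson continuous_on_eq_continuous_at holomorphic_on_imp_continuous_on)
  show "is_pole (\<lambda>z. f z / (1 + f z)) z \<and> f z / (1 + f z) = 0 \<or>
        (\<lambda>z. f z / (1 + f z)) \<midarrow>z\<rightarrow> f z / (1 + f z)"
  proof (cases "1 + f z = 0")
    case False
    then have "isCont (\<lambda>z. f z / (1 + f z)) z"
      using cont by (intro continuous_intros) auto
    then show ?thesis
      by (simp add: isCont_def)
  next
    case True
    have "(\<lambda>z. 1 + f z) holomorphic_on D"
      using f by (intro holomorphic_intros)
    then obtain r where r: "0 < r" "ball z r \<subseteq> D"
      "\<And>w. w \<in> ball z r - {z} \<Longrightarrow> 1 + f w \<noteq> 0"
      using isolated_zeros[OF _ D z True z0] by metis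
    have "\<forall>\<^sub>F w in at z. w \<in> ball z r - {z}"
      using r(1) by (intro eventually_at_in_open) auto
    then have "\<forall>\<^sub>F w in at z. 1 + f w \<noteq> 0"
      by eventually_elim (use r in auto)
    moreover have "((\<lambda>w. 1 + f w) \<longlongrightarrow> 0) (at z)"
      using isContD[OF continuous_add[OF continuous_const cont]] True by metis
    ultimately have "filterlim (\<lambda>w. 1 + f w) (at 0) (at z)"
      by (simp add: filterlim_at)
    then have "is_pole (\<lambda>w. f w / (1 + f w)) z"
      using cont True by (intro is_pole_divide) auto
    then show ?thesis
      using True by simp
  qed
qed

section \<open>Positive operators and their square roots\<close>

lemma cinner_add_left: "cinner (x + y) z = cinner x z + cinner y z"
  for x :: "'a :: complex_hilbert_space"
  by (metis cinner_add_right cinner_commute complex_cnj_add)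

lemma scaleC_one [simp]: "1 *\<^sub>C x = x" for x :: "'a :: complex_vector"
  using scaleR_scaleC[of 1 x] by simp

lemma cinner_diff_right: "cinner x (y - z) = cinner x y - cinner x z"
  for x :: "'a :: complex_hilbert_space"
  using cinner_add_right[of x "y - z" z] by simp

lemma cinner_diff_left: "cinner (x - y) z = cinner x z - cinner y z"
  for x :: "'a :: complex_hilbert_space"
  using cinner_add_left[of "x - y" y z] by simp

lemma cinner_zero_right [simp]: "cinner x 0 = 0" for x :: "'a :: complex_hilbert_space"
  using cinner_diff_right[of x 0 0] by simp

lemma cinner_scaleR_right: "cinner x (r *\<^sub>R y) = of_real r * cinner x y"
  for x :: "'a :: complex_hilbert_space"
  by (simp add: scaleR_scaleC cinner_scaleC_right)

lemma cinner_scaleR_left: "cinner (r *\<^sub>R x) y = of_real r * cinner x y"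
  for x :: "'a :: complex_hilbert_space"
  by (simp add: scaleR_scaleC cinner_scaleC_left)

lemma cinner_same: "cinner x x = of_real ((norm x)\<^sup>2)" for x :: "'a :: complex_hilbert_space"
proof -
  have "sqrt (Re (cinner x x)) \<ge> 0"
    using norm_ge_zero[of x] by (simp only: norm_eq_sqrt_cinner)
  then have "Re (cinner x x) = (norm x)\<^sup>2"
    by (simp add: norm_eq_sqrt_cinner)
  moreover have "Im (cinner x x) = 0"
    using arg_cong[OF cinner_commute[of x x], of Im] by simp
  ultimately show ?thesis
    by (simp add: complex_eq_iff)
qed

text \<open>The triangle inequality is already an axiom of the normed space, so squaring it yields
  the real part of Cauchy-Schwarz.\<close>

lemma Re_cinner_le: "Re (cinner x y) \<le> norm x * norm y" for x :: "'a :: complex_hilbert_space"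
proof -
  have "(norm (x + y))\<^sup>2 = Re (cinner (x + y) (x + y))"
    by (simp only: cinner_same Re_complex_of_real)
  also have "\<dots> = (norm x)\<^sup>2 + (norm y)\<^sup>2 + 2 * Re (cinner x y)"
    using arg_cong[OF cinner_commute[of x y], of Re]
    by (simp add: cinner_add_left cinner_add_right cinner_same[of x] cinner_same[of y])
  finally show ?thesis
    using power_mono[OF norm_triangle_ineq[of x y], of 2] by (simp add: power2_sum)
qed

lemma norm_cinner_le: "cmod (cinner x y) \<le> norm x * norm y"
  for x :: "'a :: complex_hilbert_space"
proof (cases "cinner x y = 0")
  case False
  \<comment> \<open>A unimodular factor that rotates the inner product onto the positive real
    axis.\<close>
  define c where "c = cnj (cinner x y) / cmod (cinner x y)"
  have "c * cinner x y = of_real (cmod (cinner x y))"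
    using False complex_norm_square[of "cinner x y"]
    by (simp add: c_def mult.commute power2_eq_square)
      (metis nonzero_mult_div_cancel_left of_real_eq_0_iff norm_eq_zero)
  then have "cmod (cinner x y) = Re (cinner x (c *\<^sub>C y))"
    by (simp add: cinner_scaleC_right)
  also have "\<dots> \<le> norm x * norm (c *\<^sub>C y)"
    by (rule Re_cinner_le)
  also have "\<dots> = norm x * norm y"
    using False by (simp add: norm_scaleC c_def norm_divide)
  finally show ?thesis .
qed auto

lemma bounded_linear_cinner_right: "bounded_linear (cinner x)"
  for x :: "'a :: complex_hilbert_space"
  by (rule bounded_linear_intro[where K = "norm x"])
    (simp_all add: cinner_add_right cinner_scaleR_right scaleR_conv_of_real
      norm_cinner_le mult.commute[of "norm _" "norm x"])

lemma bounded_linear_cinner_left: "bounded_linear (\<lambda>x. cinner x y)"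
  for y :: "'a :: complex_hilbert_space"
  by (rule bounded_linear_intro[where K = "norm y"])
    (simp_all add: cinner_add_left cinner_scaleR_left scaleR_conv_of_real norm_cinner_le)

section \<open>Complex-linear operators and positivity\<close>

lemma bounded_operatorsD:
  "T \<in> bounded_operators \<Longrightarrow> blinfun_apply T (c *\<^sub>C x) = c *\<^sub>C blinfun_apply T x"
  by (simp add: bounded_operators_def)

lemmas blinfun_simps =
  blinfun.add_left blinfun.add_right blinfun.diff_left blinfun.diff_right
  blinfun.scaleR_left blinfun.scaleR_right blinfun.minus_left blinfun.minus_right
  scaleC_blinfun.rep_eq

lemma blinfun_compose_assoc: "(R o\<^sub>L S) o\<^sub>L T = R o\<^sub>L (S o\<^sub>L T)"
  by (rule blinfun_eqI) simp

lemma id_blinfun_compose [simp]: "id_blinfun o\<^sub>L T = T" "T o\<^sub>L id_blinfun = T"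
  by (rule blinfun_eqI, simp)+

lemmas continuous_on_apply [continuous_intros] =
  bounded_linear.continuous_on[OF blinfun.bounded_linear_left]

lemmas continuous_on_cinner [continuous_intros] =
  bounded_linear.continuous_on[OF bounded_linear_cinner_right]
  bounded_linear.continuous_on[OF bounded_linear_cinner_left]

text \<open>Positivity makes the quadratic form real. By polarisation, reality at x + y matches the
  imaginary parts and reality at x + i y matches the real parts of the two sides.\<close>

lemma positive_operator_symmetric:
  assumes "positive_operator T"
  shows "cinner x (blinfun_apply T y) = cinner (blinfun_apply T x) y"
proof -
  let ?q = "\<lambda>x y. cinner x (blinfun_apply T y)"
  have lin: "T \<in> bounded_operators" and real: "Im (?q v v) = 0" for v
    using assms by (auto simp: positive_operator_def complex_nonneg_Reals_iff)
  have 1: "Im (?q x y) + Im (?q y x) = 0"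
    using real[of "x + y"] real[of x] real[of y]
    by (simp add: cinner_add_left cinner_add_right blinfun_simps)
  have 2: "Re (?q x y) - Re (?q y x) = 0"
    using real[of "x + \<i> *\<^sub>C y"] real[of x] real[of y] lin
    by (simp add: cinner_add_left cinner_add_right blinfun_simps bounded_operatorsD
        cinner_scaleC_left cinner_scaleC_right)
  have "?q x y = cnj (?q y x)"
    using 1 2 by (simp add: complex_eq_iff)
  then show ?thesis
    by (metis cinner_commute)
qed

text \<open>This is T^2 <= c T in quadratic form, obtained without a square root: test positivity on
  x - (1/c) T x and bound the last term <Tx, T T x> by c |Tx|^2. A positive bound \<open>c\<close>
  in place of \<open>norm T\<close> keeps the division meaningful for \<open>T = 0\<close>.\<close>

lemma positive_operator_norm_sq_le:
  assumes T: "positive_operator T" and c: "norm T \<le> c" "c > 0"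
  shows "(norm (blinfun_apply T x))\<^sup>2 \<le> c * Re (cinner x (blinfun_apply T x))"
proof -
  let ?y = "blinfun_apply T x"
  have "0 \<le> Re (cinner (x - (1/c) *\<^sub>R ?y) (blinfun_apply T (x - (1/c) *\<^sub>R ?y)))"
    using T by (auto simp: positive_operator_def complex_nonneg_Reals_iff)
  also have "\<dots> = Re (cinner x ?y) - 2/c * (norm ?y)\<^sup>2 + 1/c\<^sup>2 * Re (cinner ?y (blinfun_apply T ?y))"
    by (simp add: blinfun_simps cinner_diff_left cinner_diff_right cinner_scaleR_left
        cinner_scaleR_right cinner_same positive_operator_symmetric[OF T, of x ?y]
        algebra_simps power2_eq_square)
  finally have 1: "0 \<le> Re (cinner x ?y) - 2/c * (norm ?y)\<^sup>2 + 1/c\<^sup>2 * Re (cinner ?y (blinfun_apply T ?y))" .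
  have "Re (cinner ?y (blinfun_apply T ?y)) \<le> norm ?y * norm (blinfun_apply T ?y)"
    by (rule Re_cinner_le)
  also have "\<dots> \<le> norm ?y * (c * norm ?y)"
    using norm_blinfun[of T ?y] c by (intro mult_left_mono order.trans[OF norm_blinfun] mult_right_mono) auto
  finally have "1/c\<^sup>2 * Re (cinner ?y (blinfun_apply T ?y)) \<le> 1/c\<^sup>2 * (norm ?y * (c * norm ?y))"
    by (intro mult_left_mono) auto
  also have "\<dots> = 1/c * (norm ?y)\<^sup>2"
    using c by (simp add: power2_eq_square)
  finally have "(norm ?y)\<^sup>2 / c \<le> Re (cinner x ?y)"
    using 1 by (simp add: algebra_simps)
  then show ?thesis
    using c by (simp add: field_simps)
qed

lemma positive_operator_apply_eq_0:
  assumes T: "positive_operator T" and "cinner x (blinfun_apply T x) = 0"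
  shows "blinfun_apply T x = 0"
proof -
  have "norm T \<le> norm T + 1" "norm T + 1 > 0"
    by (simp_all add: add_nonneg_pos)
  from positive_operator_norm_sq_le[OF T this, of x] show ?thesis
    using assms(2) by simp
qed

text \<open>Expanding |x - (1/c) T x|^2 and inserting T^2 <= c T leaves |x|^2 minus a nonnegative
  term. This provides the contraction on which the square root iteration runs.\<close>

lemma norm_id_minus_positive_operator:
  assumes T: "positive_operator T" and c: "norm T \<le> c" "c > 0"
  shows "norm (id_blinfun - (1/c) *\<^sub>R T) \<le> 1"
proof (rule norm_blinfun_bound)
  fix x
  let ?y = "blinfun_apply T x"
  have "(norm (x - (1/c) *\<^sub>R ?y))\<^sup>2 = Re (cinner (x - (1/c) *\<^sub>R ?y) (x - (1/c) *\<^sub>R ?y))"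
    by (simp add: cinner_same)
  also have "\<dots> = (norm x)\<^sup>2 - 2/c * Re (cinner x ?y) + 1/c\<^sup>2 * (norm ?y)\<^sup>2"
    using positive_operator_symmetric[OF T, of x x]
    by (simp add: cinner_diff_left cinner_diff_right cinner_scaleR_left
        cinner_scaleR_right cinner_same[of x] cinner_same[of ?y] algebra_simps power2_eq_square)
  also have "\<dots> \<le> (norm x)\<^sup>2 - 2/c * Re (cinner x ?y) + 1/c\<^sup>2 * (c * Re (cinner x ?y))"
    using positive_operator_norm_sq_le[OF T c] by (intro add_left_mono mult_left_mono) auto
  also have "(norm x)\<^sup>2 - 2/c * Re (cinner x ?y) + 1/c\<^sup>2 * (c * Re (cinner x ?y))
      = (norm x)\<^sup>2 - 1/c * Re (cinner x ?y)"
    using c by (simp add: power2_eq_square field_simps)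
  also have "\<dots> \<le> (norm x)\<^sup>2"
    using T c by (auto simp: positive_operator_def complex_nonneg_Reals_iff)
  finally have "norm (x - (1/c) *\<^sub>R ?y) \<le> norm x"
    by (rule power2_le_imp_le) simp
  then show "norm (blinfun_apply (id_blinfun - (1/c) *\<^sub>R T) x) \<le> 1 * norm x"
    by (simp add: blinfun_simps)
qed simp

lemma LIMSEQ_in_closure:
  fixes S :: "'a :: metric_space set"
  assumes "\<And>n. f n \<in> S" "f \<longlonglongrightarrow> x"
  shows "x \<in> closure S"
  using assms closure_sequential by blast

section \<open>Norm convergence of the square root iteration\<close>

text \<open>
  Both iterations approximate \<open>1 - \<surd>(1 - C)\<close>. For \<open>\<parallel>C\<parallel> \<le> 1\<close> the scalar iteration with \<open>\<kappa> = 1\<close> dominates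
  the increments of the operator iteration, which therefore converges in norm even though \<open>\<surd>\<close> is not
  analytic at \<open>0\<close>.
\<close>

primrec sqrt_iter :: "real \<Rightarrow> nat \<Rightarrow> real" where
  "sqrt_iter \<kappa> 0 = 0"
| "sqrt_iter \<kappa> (Suc n) = (\<kappa> + (sqrt_iter \<kappa> n)\<^sup>2) / 2"

primrec op_sqrt_iter :: "('a :: real_normed_vector \<Rightarrow>\<^sub>L 'a) \<Rightarrow> nat \<Rightarrow> 'a \<Rightarrow>\<^sub>L 'a" where
  "op_sqrt_iter C 0 = 0"
| "op_sqrt_iter C (Suc n) = (1/2) *\<^sub>R (C + (op_sqrt_iter C n o\<^sub>L op_sqrt_iter C n))"

lemma sqrt_iter_bounds:
  assumes "0 \<le> \<kappa>" "\<kappa> \<le> 1"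
  shows "0 \<le> sqrt_iter \<kappa> n \<and> sqrt_iter \<kappa> n \<le> 1 \<and> sqrt_iter \<kappa> n \<le> sqrt_iter \<kappa> (Suc n)"
proof (induction n)
  case (Suc n)
  then have "(sqrt_iter \<kappa> n)\<^sup>2 \<le> 1" "(sqrt_iter \<kappa> n)\<^sup>2 \<le> (sqrt_iter \<kappa> (Suc n))\<^sup>2"
    by (auto simp: power_le_one intro!: power_mono simp del: sqrt_iter.simps(2))
  then show ?case
    using assms by auto
qed (use assms in auto)

lemma sqrt_iter_tendsto:
  assumes "0 \<le> \<kappa>" "\<kappa> \<le> 1"
  shows "sqrt_iter \<kappa> \<longlonglongrightarrow> 1 - sqrt (1 - \<kappa>)"
proof -
  have "incseq (sqrt_iter \<kappa>)"
    using sqrt_iter_bounds[OF assms] by (intro incseq_SucI) blast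
  then obtain L where L: "sqrt_iter \<kappa> \<longlonglongrightarrow> L"
    using incseq_convergent[of "sqrt_iter \<kappa>" 1] sqrt_iter_bounds[OF assms] by blast
  \<comment> \<open>The fixed point equation is quadratic in \<open>L\<close>; this bound selects
    the smaller root.\<close>
  have "L \<le> 1"
    using LIMSEQ_le_const2[OF L] sqrt_iter_bounds[OF assms] by blast
  have "(\<lambda>n. sqrt_iter \<kappa> (Suc n)) \<longlonglongrightarrow> (\<kappa> + L\<^sup>2) / 2"
    unfolding sqrt_iter.simps by (intro tendsto_intros L) auto
  with L have "L = (\<kappa> + L\<^sup>2) / 2"
    using LIMSEQ_unique LIMSEQ_Suc by blast
  then have "(1 - L)\<^sup>2 = 1 - \<kappa>"
    by (simp add: power2_diff field_simps)
  then have "sqrt (1 - \<kappa>) = 1 - L"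
    using \<open>L \<le> 1\<close> by (metis diff_ge_0_iff_ge real_sqrt_unique)
  then show ?thesis
    using L by simp
qed

text \<open>The iterates are polynomials in \<open>C\<close>. In the limit this makes the square
  root commute with everything that commutes with \<open>X\<close>, which uniqueness relies
  on.\<close>

lemma op_sqrt_iter_commute:
  assumes "C o\<^sub>L T = T o\<^sub>L C"
  shows "op_sqrt_iter C n o\<^sub>L T = T o\<^sub>L op_sqrt_iter C n"
proof (induction n)
  case (Suc n)
  show ?case
  proof (rule blinfun_eqI)
    fix x
    have "blinfun_apply (op_sqrt_iter C n) (blinfun_apply T y) =
        blinfun_apply T (blinfun_apply (op_sqrt_iter C n) y)"
      "blinfun_apply C (blinfun_apply T y) = blinfun_apply T (blinfun_apply C y)" for y
      using Suc assms by (metis blinfun_apply_blinfun_compose)+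
    then show "blinfun_apply (op_sqrt_iter C (Suc n) o\<^sub>L T) x =
        blinfun_apply (T o\<^sub>L op_sqrt_iter C (Suc n)) x"
      by (simp add: blinfun_simps)
  qed
qed (auto intro!: blinfun_eqI)

lemma op_sqrt_iter_commute_iter:
  "op_sqrt_iter C n o\<^sub>L op_sqrt_iter C m = op_sqrt_iter C m o\<^sub>L op_sqrt_iter C n"
  \<comment> \<open>Used twice: each iterate commutes with \<open>C\<close>, hence with every other
    iterate.\<close>
  by (rule op_sqrt_iter_commute, rule sym, rule op_sqrt_iter_commute) simp

lemma norm_op_sqrt_iter:
  assumes "norm C \<le> 1"
  shows "norm (op_sqrt_iter C n) \<le> sqrt_iter 1 n"
proof (induction n)
  case (Suc n)
  have "norm (op_sqrt_iter C n o\<^sub>L op_sqrt_iter C n) \<le> norm (op_sqrt_iter C n) * norm (op_sqrt_iter C n)"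
    by (rule norm_blinfun_compose)
  also have "\<dots> \<le> (sqrt_iter 1 n)\<^sup>2"
    using Suc by (auto simp: power2_eq_square intro!: mult_mono intro: order_trans[OF norm_ge_zero])
  finally show ?case
    using assms norm_triangle_ineq[of C "op_sqrt_iter C n o\<^sub>L op_sqrt_iter C n"] by simp
qed simp

text \<open>As the iterates commute, a new increment is half the product of the previous increment
  and the sum of the two previous iterates. The scalar iteration at 1 factors in the same way, so
  the norm bounds propagate; its increments telescope and thus form a summable majorant.\<close>

lemma norm_op_sqrt_iter_diff:
  assumes "norm C \<le> 1"
  shows "norm (op_sqrt_iter C (Suc n) - op_sqrt_iter C n) \<le> sqrt_iter 1 (Suc n) - sqrt_iter 1 n"
proof (induction n)
  case 0
  then show ?case
    using assms by simp
next
  case (Suc n)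
  define R S where "R = op_sqrt_iter C n" and "S = op_sqrt_iter C (Suc n)"
  define r s where "r = sqrt_iter 1 n" and "s = sqrt_iter 1 (Suc n)"
  have rs: "norm R \<le> r" "norm S \<le> s" "norm (S - R) \<le> s - r" "r \<le> s"
    unfolding R_def S_def r_def s_def
    using Suc norm_op_sqrt_iter[OF assms] sqrt_iter_bounds[of 1 n, OF zero_le_one order_refl] by blast+
  have "op_sqrt_iter C (Suc (Suc n)) - S = (1/2) *\<^sub>R ((S - R) o\<^sub>L (S + R))"
  proof (rule blinfun_eqI)
    fix x
    have 1: "blinfun_apply S (blinfun_apply R x) = blinfun_apply R (blinfun_apply S x)"
      unfolding R_def S_def by (metis op_sqrt_iter_commute_iter blinfun_apply_blinfun_compose)
    have "op_sqrt_iter C (Suc (Suc n)) = (1/2) *\<^sub>R (C + (S o\<^sub>L S))"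
      by (simp add: S_def)
    moreover have "blinfun_apply S x = (1/2) *\<^sub>R (blinfun_apply C x + blinfun_apply R (blinfun_apply R x))"
      by (simp add: R_def S_def blinfun_simps)
    ultimately show "blinfun_apply (op_sqrt_iter C (Suc (Suc n)) - S) x =
        blinfun_apply ((1/2) *\<^sub>R ((S - R) o\<^sub>L (S + R))) x"
      by (simp add: blinfun_simps 1) (simp add: algebra_simps)
  qed
  also have "norm \<dots> \<le> (1/2) * (norm (S - R) * norm (S + R))"
    by (simp add: norm_blinfun_compose)
  also have "\<dots> \<le> (1/2) * ((s - r) * (s + r))"
    using rs norm_triangle_ineq[of S R]
    by (intro mult_left_mono mult_mono) (auto intro: order_trans[OF norm_ge_zero])
  also have "\<dots> = sqrt_iter 1 (Suc (Suc n)) - s"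
    unfolding s_def r_def sqrt_iter.simps by (simp add: power2_eq_square field_simps)
  finally show ?case
    by (simp add: S_def s_def)
qed

text \<open>Completeness of the operator space turns the summable majorant into norm convergence.
  The fixed point equation for \<open>R\<close> says (1 - R)^2 = 1 - C.\<close>

lemma op_sqrt_iter_convergent:
  fixes C :: "'a :: banach \<Rightarrow>\<^sub>L 'a"
  assumes "norm C \<le> 1"
  obtains R where "op_sqrt_iter C \<longlonglongrightarrow> R" "norm R \<le> 1" "R = (1/2) *\<^sub>R (C + (R o\<^sub>L R))"
proof -
  have "summable (\<lambda>n. sqrt_iter 1 (Suc n) - sqrt_iter 1 n)"
    using sqrt_iter_tendsto[of 1] by (intro telescope_summable) auto
  then have "summable (\<lambda>n. op_sqrt_iter C (Suc n) - op_sqrt_iter C n)"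
    by (rule summable_comparison_test'[where N = 0]) (rule norm_op_sqrt_iter_diff[OF assms])
  then have "convergent (\<lambda>n. \<Sum>i<n. op_sqrt_iter C (Suc i) - op_sqrt_iter C i)"
    by (simp add: summable_iff_convergent)
  then obtain R where R: "op_sqrt_iter C \<longlonglongrightarrow> R"
    by (auto simp: convergent_def sum_lessThan_telescope simp del: op_sqrt_iter.simps(2))
  have "norm (op_sqrt_iter C n) \<le> 1" for n
    using norm_op_sqrt_iter[OF assms, of n] sqrt_iter_bounds[of 1 n] by simp
  then have norm: "norm R \<le> 1"
    by (intro LIMSEQ_le_const2[OF tendsto_norm[OF R]]) auto
  have "(\<lambda>n. op_sqrt_iter C (Suc n)) \<longlonglongrightarrow> (1/2) *\<^sub>R (C + (R o\<^sub>L R))"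
    unfolding op_sqrt_iter.simps
    by (intro tendsto_intros R bounded_bilinear.tendsto[OF bounded_bilinear_blinfun_compose])
  then have "R = (1/2) *\<^sub>R (C + (R o\<^sub>L R))"
    using R LIMSEQ_unique LIMSEQ_Suc by blast
  with R norm show thesis
    by (rule that)
qed

section \<open>Existence and uniqueness of the positive square root\<close>

lemma bounded_operators_intros:
  "id_blinfun \<in> bounded_operators" "0 \<in> bounded_operators"
  "S \<in> bounded_operators \<Longrightarrow> T \<in> bounded_operators \<Longrightarrow> S + T \<in> bounded_operators"
  "S \<in> bounded_operators \<Longrightarrow> T \<in> bounded_operators \<Longrightarrow> S - T \<in> bounded_operators"
  "S \<in> bounded_operators \<Longrightarrow> T \<in> bounded_operators \<Longrightarrow> S o\<^sub>L T \<in> bounded_operators"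
  "S \<in> bounded_operators \<Longrightarrow> c *\<^sub>C S \<in> bounded_operators"
  "S \<in> bounded_operators \<Longrightarrow> r *\<^sub>R S \<in> bounded_operators"
  by (simp_all add: bounded_operators_def blinfun_simps scaleR_scaleC scaleC_add_right
      complex_vector.scale_right_diff_distrib scaleC_scaleC mult.commute)

text \<open>Together with \<open>closed_symmetric\<close>, this carries properties of the iterates
  over to their norm limit.\<close>

lemma closed_bounded_operators: "closed (bounded_operators :: ('a :: complex_hilbert_space \<Rightarrow>\<^sub>L 'a) set)"
proof -
  have "closed {T :: 'a \<Rightarrow>\<^sub>L 'a. blinfun_apply T (c *\<^sub>C x) = c *\<^sub>C blinfun_apply T x}" for c x
    by (intro closed_Collect_eq continuous_intros bounded_linear.continuous_on[OF bounded_linear_scaleC])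
  then show ?thesis
    unfolding bounded_operators_def by (intro closed_Collect_all)
qed

lemma closed_symmetric: "closed {T :: 'a :: complex_hilbert_space \<Rightarrow>\<^sub>L 'a.
  \<forall>x y. cinner x (blinfun_apply T y) = cinner (blinfun_apply T x) y}"
  by (intro closed_Collect_all closed_Collect_eq continuous_intros)

lemma op_sqrt_iter_symmetric:
  assumes "\<And>x y. cinner x (blinfun_apply C y) = cinner (blinfun_apply C x) y"
  shows "cinner x (blinfun_apply (op_sqrt_iter C n) y) = cinner (blinfun_apply (op_sqrt_iter C n) x) y"
proof (induction n arbitrary: x y)
  case (Suc n)
  show ?case
    by (simp add: blinfun_simps cinner_add_left cinner_add_right cinner_scaleR_left
        cinner_scaleR_right assms Suc)
next
  case 0
  show ?case
    using cinner_zero_right cinner_commute[of 0 y] by simp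
qed

lemma op_sqrt_iter_bounded_operators:
  assumes "C \<in> bounded_operators"
  shows "op_sqrt_iter C n \<in> bounded_operators"
  using assms by (induction n) (auto intro: bounded_operators_intros)

text \<open>\<open>op_alg U\<close> consists of polynomials without constant term, so the
  coefficient of the identity has to be split off. Since (a + Q)^2 = a^2 + 2aQ + Q^2, that
  coefficient obeys the scalar recursion and the remainder stays in the algebra.\<close>

lemma op_sqrt_iter_op_alg:
  assumes U: "U \<in> bounded_operators" and C: "C = \<kappa> *\<^sub>R id_blinfun + P" "P \<in> op_alg U"
  shows "op_sqrt_iter C n - sqrt_iter \<kappa> n *\<^sub>R id_blinfun \<in> op_alg U"
proof (induction n)
  case 0
  show ?case
    using is_subalgebra_op_alg[OF U] complex_vector.subspace_0 by (auto simp: is_subalgebra_def)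
next
  case (Suc n)
  define a Q where "a = sqrt_iter \<kappa> n" and "Q = op_sqrt_iter C n - a *\<^sub>R id_blinfun"
  have R: "op_sqrt_iter C n = a *\<^sub>R id_blinfun + Q"
    by (simp add: Q_def)
  have sub: "csubspace (op_alg U)" and mult: "Q o\<^sub>L Q \<in> op_alg U" and Q: "Q \<in> op_alg U"
    using is_subalgebra_op_alg[OF U] Suc by (auto simp: is_subalgebra_def Q_def a_def)
  have "op_sqrt_iter C (Suc n) - sqrt_iter \<kappa> (Suc n) *\<^sub>R id_blinfun
      = (1/2) *\<^sub>R (P + (2 * a) *\<^sub>R Q + (Q o\<^sub>L Q))"
    unfolding op_sqrt_iter.simps sqrt_iter.simps R a_def[symmetric]
    unfolding C(1)
    by (rule blinfun_eqI) (simp add: blinfun_simps algebra_simps power2_eq_square add_divide_distrib,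
      metis scaleR_add_left field_sum_of_halves)
  also have "\<dots> \<in> op_alg U"
    using sub C(2) Q mult unfolding scaleR_scaleC
    by (intro complex_vector.subspace_scale complex_vector.subspace_add)
  finally show ?case .
qed

text \<open>The root is sqrt c (1 - R), with \<open>R\<close> the limit of the iteration for C = 1 -
  X/c. The commutation property serves uniqueness; the closure property is what lets monotone
  independence reach the square root.\<close>

lemma positive_sqrt_exists:
  assumes X: "positive_operator X"
  obtains A where "positive_operator A" "A o\<^sub>L A = X"
    "\<And>T. X o\<^sub>L T = T o\<^sub>L X \<Longrightarrow> A o\<^sub>L T = T o\<^sub>L A"
    "A - id_blinfun \<in> closure (op_alg (X - id_blinfun))"
proof -
  \<comment> \<open>The bound by \<open>norm X\<close> makes \<open>C\<close> a contraction; the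
    bound by 1 puts \<kappa> = 1 - 1/c into [0, 1].\<close>
  define c where "c = max 1 (norm X)"
  define C where "C = id_blinfun - (1/c) *\<^sub>R X"
  have c: "c \<ge> 1" "norm X \<le> c" "c > 0"
    by (auto simp: c_def)
  have XB: "X \<in> bounded_operators"
    using X by (simp add: positive_operator_def)
  have normC: "norm C \<le> 1"
    unfolding C_def by (rule norm_id_minus_positive_operator[OF X c(2,3)])
  obtain R where lim: "op_sqrt_iter C \<longlonglongrightarrow> R" and R1: "norm R \<le> 1"
    and R: "R = (1/2) *\<^sub>R (C + (R o\<^sub>L R))"
    using op_sqrt_iter_convergent[OF normC] .
  define A where "A = sqrt c *\<^sub>R (id_blinfun - R)"
  have CB: "C \<in> bounded_operators"
    unfolding C_def by (intro bounded_operators_intros XB)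
  have RB: "R \<in> bounded_operators"
    using closed_sequentially[OF closed_bounded_operators op_sqrt_iter_bounded_operators[OF CB] lim] .
  have symC: "cinner x (blinfun_apply C y) = cinner (blinfun_apply C x) y" for x y
    by (simp add: C_def blinfun_simps cinner_diff_left cinner_diff_right cinner_scaleR_left
        cinner_scaleR_right positive_operator_symmetric[OF X])
  have symR: "cinner x (blinfun_apply R y) = cinner (blinfun_apply R x) y" for x y
    using closed_sequentially[OF closed_symmetric _ lim] op_sqrt_iter_symmetric[OF symC] by blast
  have "positive_operator A"
    unfolding positive_operator_def
  proof (intro conjI allI)
    show "A \<in> bounded_operators"
      unfolding A_def by (intro bounded_operators_intros RB)
    fix x
    have "Im (cinner x (blinfun_apply R x)) = 0"
      using arg_cong[OF cinner_commute[of x "blinfun_apply R x"], of Im] symR[of x x] by simp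
    moreover have "Re (cinner x (blinfun_apply R x)) \<le> (norm x)\<^sup>2"
    proof -
      have "Re (cinner x (blinfun_apply R x)) \<le> norm x * norm (blinfun_apply R x)"
        by (rule Re_cinner_le)
      also have "\<dots> \<le> norm x * (1 * norm x)"
        using R1 by (intro mult_left_mono order.trans[OF norm_blinfun] mult_right_mono) auto
      finally show ?thesis
        by (simp add: power2_eq_square)
    qed
    ultimately show "cinner x (blinfun_apply A x) \<in> \<real>\<^sub>\<ge>\<^sub>0"
      using c by (simp add: A_def complex_nonneg_Reals_iff blinfun_simps cinner_diff_right
          cinner_scaleR_right cinner_same)
  qed
  moreover have "A o\<^sub>L A = X"
  proof (rule blinfun_eqI)
    fix x
    let ?r = "blinfun_apply R"
    \<comment> \<open>The fixed point equation, solved for R^2 below, gives (1 - R)^2 = 1 - C =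
      X/c.\<close>
    have "?r x = (1/2) *\<^sub>R (blinfun_apply C x + ?r (?r x))"
      by (subst R) (simp add: blinfun_simps)
    from arg_cong[OF this, of "\<lambda>v. 2 *\<^sub>R v"] have "?r (?r x) = 2 *\<^sub>R ?r x - blinfun_apply C x"
      by simp
    moreover have "blinfun_apply (A o\<^sub>L A) x = (sqrt c * sqrt c) *\<^sub>R (x - ?r x - (?r x - ?r (?r x)))"
      by (simp add: A_def blinfun_simps algebra_simps)
    ultimately have "blinfun_apply (A o\<^sub>L A) x = c *\<^sub>R (x - blinfun_apply C x)"
      using c by (simp add: scaleR_2)
    then show "blinfun_apply (A o\<^sub>L A) x = blinfun_apply X x"
      using c by (simp add: C_def blinfun_simps)
  qed
  moreover have "A o\<^sub>L T = T o\<^sub>L A" if comm: "X o\<^sub>L T = T o\<^sub>L X" for T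
  proof -
    have "blinfun_apply X (blinfun_apply T x) = blinfun_apply T (blinfun_apply X x)" for x
      using comm by (metis blinfun_apply_blinfun_compose)
    then have "C o\<^sub>L T = T o\<^sub>L C"
      by (intro blinfun_eqI) (simp add: C_def blinfun_simps)
    then have "(\<lambda>n. op_sqrt_iter C n o\<^sub>L T) = (\<lambda>n. T o\<^sub>L op_sqrt_iter C n)"
      by (intro ext op_sqrt_iter_commute)
    moreover have "(\<lambda>n. op_sqrt_iter C n o\<^sub>L T) \<longlonglongrightarrow> (R o\<^sub>L T)"
      "(\<lambda>n. T o\<^sub>L op_sqrt_iter C n) \<longlonglongrightarrow> (T o\<^sub>L R)"
      by (intro tendsto_intros lim bounded_bilinear.tendsto[OF bounded_bilinear_blinfun_compose])+
    ultimately have "R o\<^sub>L T = T o\<^sub>L R"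
      by (intro LIMSEQ_unique) simp_all
    then have "blinfun_apply R (blinfun_apply T x) = blinfun_apply T (blinfun_apply R x)" for x
      by (metis blinfun_apply_blinfun_compose)
    then show ?thesis
      by (intro blinfun_eqI) (simp add: A_def blinfun_simps)
  qed
  moreover have "A - id_blinfun \<in> closure (op_alg (X - id_blinfun))"
  proof -
    define U where "U = X - id_blinfun"
    define \<kappa> where "\<kappa> = 1 - 1/c"
    have UB: "U \<in> bounded_operators"
      unfolding U_def by (intro bounded_operators_intros XB)
    have sub: "csubspace (op_alg U)"
      using is_subalgebra_op_alg[OF UB] by (simp add: is_subalgebra_def)
    have "op_power U 1 \<in> op_alg U"
      unfolding op_alg_def by (rule complex_vector.span_base) auto
    then have "U \<in> op_alg U"
      by (simp add: op_power_def)
    then have "(- (1/c)) *\<^sub>R U \<in> op_alg U"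
      unfolding scaleR_scaleC by (intro complex_vector.subspace_scale sub)
    moreover have "C = \<kappa> *\<^sub>R id_blinfun + (- (1/c)) *\<^sub>R U"
      by (simp add: C_def \<kappa>_def U_def algebra_simps)
    ultimately have "op_sqrt_iter C n - sqrt_iter \<kappa> n *\<^sub>R id_blinfun \<in> op_alg U" for n
      using UB by (intro op_sqrt_iter_op_alg)
    then have mem: "(- sqrt c) *\<^sub>R (op_sqrt_iter C n - sqrt_iter \<kappa> n *\<^sub>R id_blinfun) \<in> op_alg U" for n
      unfolding scaleR_scaleC by (intro complex_vector.subspace_scale sub)
    \<comment> \<open>Because 1 - \<kappa> = 1/c, the scalar part tends to 1 - 1/sqrt c. Scaling by
      - sqrt c therefore leaves sqrt c (1 - R) - 1, with constant exactly -1.\<close>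
    have "(\<lambda>n. (- sqrt c) *\<^sub>R (op_sqrt_iter C n - sqrt_iter \<kappa> n *\<^sub>R id_blinfun))
        \<longlonglongrightarrow> (- sqrt c) *\<^sub>R (R - (1 - sqrt (1 - \<kappa>)) *\<^sub>R id_blinfun)"
      using c by (intro tendsto_intros lim sqrt_iter_tendsto) (auto simp: \<kappa>_def)
    also have "(- sqrt c) *\<^sub>R (R - (1 - sqrt (1 - \<kappa>)) *\<^sub>R id_blinfun) = A - id_blinfun"
      using c by (simp add: A_def \<kappa>_def real_sqrt_divide algebra_simps)
    finally show ?thesis
      using mem unfolding U_def by (rule LIMSEQ_in_closure[rotated])
  qed
  ultimately show thesis
    using that by blast
qed

text \<open>Commutation gives (A + S)(A - S) = 0. For y = (A - S)x the nonnegative numbers <y, Ay>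
  and <y, Sy> sum to zero, so Ay = Sy = 0, and hence |y|^2 = <x, (A - S)y> = 0.\<close>

lemma positive_sqrt_unique:
  assumes A: "positive_operator A" and S: "positive_operator S"
    and sq: "A o\<^sub>L A = S o\<^sub>L S" and comm: "A o\<^sub>L S = S o\<^sub>L A"
  shows "S = A"
proof (rule blinfun_eqI)
  fix x
  let ?A = "blinfun_apply A" and ?S = "blinfun_apply S"
  have c: "?A (?S v) = ?S (?A v)" "?A (?A v) = ?S (?S v)" for v
    using sq comm by (metis blinfun_apply_blinfun_compose)+
  define y where "y = ?A x - ?S x"
  have "?A y + ?S y = 0"
    by (simp add: y_def blinfun_simps c)
  then have "cinner y (?A y) + cinner y (?S y) = 0"
    by (simp flip: cinner_add_right)
  moreover have "cinner y (?A y) \<in> \<real>\<^sub>\<ge>\<^sub>0" "cinner y (?S y) \<in> \<real>\<^sub>\<ge>\<^sub>0"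
    using A S by (auto simp: positive_operator_def)
  ultimately have "cinner y (?A y) = 0" "cinner y (?S y) = 0"
    by (auto simp: complex_nonneg_Reals_iff complex_eq_iff)
  then have "?A y = 0" "?S y = 0"
    using A S positive_operator_apply_eq_0 by blast+
  moreover have "cinner y y = cinner x (?A y - ?S y)"
    by (simp add: y_def cinner_diff_left cinner_diff_right blinfun_simps
        positive_operator_symmetric[OF A] positive_operator_symmetric[OF S])
  ultimately have "cinner y y = 0"
    by simp
  then show "?S x = ?A x"
    by (simp add: y_def cinner_same)
qed

lemma op_sqrt_properties:
  assumes X: "positive_operator X"
  shows "positive_operator (op_sqrt X)" "op_sqrt X o\<^sub>L op_sqrt X = X"
    "op_sqrt X - id_blinfun \<in> closure (op_alg (X - id_blinfun))"
proof -
  obtain A where A: "positive_operator A" "A o\<^sub>L A = X"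
    "\<And>T. X o\<^sub>L T = T o\<^sub>L X \<Longrightarrow> A o\<^sub>L T = T o\<^sub>L A"
    "A - id_blinfun \<in> closure (op_alg (X - id_blinfun))"
    using positive_sqrt_exists[OF X] by metis
  have "op_sqrt X = A"
    unfolding op_sqrt_def
  proof (rule the_equality)
    fix S assume S: "positive_operator S \<and> S o\<^sub>L S = X"
    \<comment> \<open>A competing root commutes with its own square \<open>X\<close>, and hence with
      \<open>A\<close>.\<close>
    then have "X o\<^sub>L S = S o\<^sub>L X"
      using blinfun_compose_assoc[of S S S] by simp
    then have "A o\<^sub>L S = S o\<^sub>L A"
      by (rule A(3))
    moreover have "A o\<^sub>L A = S o\<^sub>L S"
      using S A(2) by simp
    ultimately show "S = A"
      using S A(1) positive_sqrt_unique by metis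
  qed (use A(1,2) in simp)
  then show "positive_operator (op_sqrt X)" "op_sqrt X o\<^sub>L op_sqrt X = X"
    "op_sqrt X - id_blinfun \<in> closure (op_alg (X - id_blinfun))"
    using A(1,2,4) by auto
qed

section \<open>Resolvents\<close>

lemma op_power_0 [simp]: "op_power T 0 = id_blinfun"
  by (simp add: op_power_def)

lemma op_power_Suc: "op_power T (Suc k) = T o\<^sub>L op_power T k"
  by (simp add: op_power_def)

lemma op_power_Suc_right: "op_power T (Suc k) = op_power T k o\<^sub>L T"
proof (induction k)
  case 0
  then show ?case
    by (simp add: op_power_Suc)
next
  case (Suc k)
  have "op_power T (Suc (Suc k)) = T o\<^sub>L (op_power T k o\<^sub>L T)"
    by (simp only: op_power_Suc[of T "Suc k"] Suc)
  then show ?case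
    by (simp only: op_power_Suc blinfun_compose_assoc)
qed

lemma norm_op_power_le: "norm (op_power T k) \<le> norm T ^ k"
proof (induction k)
  case 0
  then show ?case
    using norm_blinfun_id_le by simp
next
  case (Suc k)
  have "norm (op_power T (Suc k)) \<le> norm T * norm (op_power T k)"
    unfolding op_power_Suc by (rule norm_blinfun_compose)
  also have "\<dots> \<le> norm T * norm T ^ k"
    by (intro mult_left_mono Suc) auto
  finally show ?case
    by simp
qed

lemma op_power_scaleC:
  assumes "T \<in> bounded_operators"
  shows "op_power (z *\<^sub>C T) k = z ^ k *\<^sub>C op_power T k"
proof (induction k)
  case (Suc k)
  show ?case
    by (rule blinfun_eqI)
      (simp add: op_power_Suc Suc blinfun_simps bounded_operatorsD[OF assms] scaleC_scaleC)
qed simp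

lemma norm_scaleC_blinfun_le: "norm (z *\<^sub>C T) \<le> cmod z * norm T"
  for T :: "'a :: complex_hilbert_space \<Rightarrow>\<^sub>L 'b :: complex_hilbert_space"
proof (rule norm_blinfun_bound)
  fix x
  have "cmod z * norm (blinfun_apply T x) \<le> cmod z * (norm T * norm x)"
    by (intro mult_left_mono norm_blinfun) auto
  then show "norm (blinfun_apply (z *\<^sub>C T) x) \<le> cmod z * norm T * norm x"
    by (simp add: scaleC_blinfun.rep_eq norm_scaleC mult.assoc)
qed auto

text \<open>Multiplying the series by \<open>W\<close> on either side shifts it by one term, so its
  sum is a two-sided inverse. Uniqueness of such inverses identifies the sum with the definite
  description in \<open>op_inverse\<close>.\<close>

lemma neumann_series:
  fixes W :: "'a :: complex_hilbert_space \<Rightarrow>\<^sub>L 'a"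
  assumes "norm W < 1"
  shows "op_power W sums op_inverse (id_blinfun - W)"
    and "(id_blinfun - W) o\<^sub>L op_inverse (id_blinfun - W) = id_blinfun"
    and "op_inverse (id_blinfun - W) o\<^sub>L (id_blinfun - W) = id_blinfun"
proof -
  have "summable (op_power W)"
    using assms by (intro summable_comparison_test'[OF summable_geometric norm_op_power_le]) auto
  then obtain N where N: "op_power W sums N"
    by (auto simp: summable_def)
  then have "(\<lambda>k. op_power W (Suc k)) sums (N - id_blinfun)"
    by (simp add: sums_Suc_iff)
  moreover have "(\<lambda>k. op_power W (Suc k)) sums (W o\<^sub>L N)"
    unfolding op_power_Suc
    by (rule bounded_linear.sums[OF bounded_bilinear.bounded_linear_right[OF bounded_bilinear_blinfun_compose] N])
  moreover have "(\<lambda>k. op_power W (Suc k)) sums (N o\<^sub>L W)"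
    unfolding op_power_Suc_right
    by (rule bounded_linear.sums[OF bounded_bilinear.bounded_linear_left[OF bounded_bilinear_blinfun_compose] N])
  ultimately have WN: "W o\<^sub>L N = N - id_blinfun" "N o\<^sub>L W = N - id_blinfun"
    using sums_unique2 by blast+
  have inv: "(id_blinfun - W) o\<^sub>L N = id_blinfun" "N o\<^sub>L (id_blinfun - W) = id_blinfun"
    using WN by (simp_all add: bounded_bilinear.diff_left[OF bounded_bilinear_blinfun_compose]
        bounded_bilinear.diff_right[OF bounded_bilinear_blinfun_compose])
  have "op_inverse (id_blinfun - W) = N"
    unfolding op_inverse_def
  proof (rule the_equality)
    fix S assume S: "S o\<^sub>L (id_blinfun - W) = id_blinfun \<and> (id_blinfun - W) o\<^sub>L S = id_blinfun"
    then have "S o\<^sub>L ((id_blinfun - W) o\<^sub>L N) = N"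
      by (simp flip: blinfun_compose_assoc)
    then show "S = N"
      by (simp add: inv)
  qed (use inv in simp)
  with N inv show "op_power W sums op_inverse (id_blinfun - W)"
    "(id_blinfun - W) o\<^sub>L op_inverse (id_blinfun - W) = id_blinfun"
    "op_inverse (id_blinfun - W) o\<^sub>L (id_blinfun - W) = id_blinfun"
    by simp_all
qed

section \<open>Resolvents and transforms on the disc of convergence\<close>

lemma mem_transform_disc: "z \<in> transform_disc T \<longleftrightarrow> cmod z * norm T < 1"
proof (cases "norm T = 0")
  \<comment> \<open>The convention 1/0 = infinity makes the disc the whole plane, and the product
    form agrees.\<close>
  case True
  then show ?thesis
    by (simp add: transform_disc_def one_ereal_def)
next
  case False
  then have "norm T > 0"
    by simp
  then show ?thesis
    by (simp add: transform_disc_def one_ereal_def field_simps)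
qed

lemma transform_disc_eq_ball: "transform_disc T = (if T = 0 then UNIV else ball 0 (1 / norm T))"
  by (auto simp: mem_transform_disc field_simps)

lemma open_transform_disc: "open (transform_disc T)"
  and convex_transform_disc: "convex (transform_disc T)"
  and zero_in_transform_disc: "0 \<in> transform_disc T"
  by (auto simp: transform_disc_eq_ball)

lemma norm_scaleC_less_one: "z \<in> transform_disc T \<Longrightarrow> norm (z *\<^sub>C T) < 1"
  using norm_scaleC_blinfun_le[of z T] by (simp add: mem_transform_disc)

lemma bounded_linear_vector_state: "bounded_linear (vector_state \<Omega>)"
  unfolding vector_state_def[abs_def]
  by (rule bounded_linear_compose[OF bounded_linear_cinner_right blinfun.bounded_linear_left])

text \<open>The first form is a recursion for the resolvent. The second evaluates the resolvent at
  any vector already exhibited as v - zTv, so candidates can be checked by substitution.\<close>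

lemma resolvent_apply:
  assumes "z \<in> transform_disc T"
  defines "G \<equiv> op_inverse (id_blinfun - z *\<^sub>C T)"
  shows "blinfun_apply G v = v + z *\<^sub>C blinfun_apply T (blinfun_apply G v)"
    and "blinfun_apply G (v - z *\<^sub>C blinfun_apply T v) = v"
proof -
  note n = neumann_series[OF norm_scaleC_less_one[OF assms(1)], folded G_def]
  show "blinfun_apply G v = v + z *\<^sub>C blinfun_apply T (blinfun_apply G v)"
    using arg_cong[OF n(2), of "\<lambda>S. blinfun_apply S v"]
    by (simp add: blinfun_simps algebra_simps)
  show "blinfun_apply G (v - z *\<^sub>C blinfun_apply T v) = v"
    using arg_cong[OF n(3), of "\<lambda>S. blinfun_apply S v"]
    by (simp add: blinfun_simps)
qed

text \<open>\<open>op_inverse\<close> yields a map that is a priori only real-linear. Complex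
  linearity follows since c G x solves u - zTu = cx, and applying \<open>G\<close> to that equation
  recovers u.\<close>

lemma resolvent_bounded_operators:
  assumes z: "z \<in> transform_disc T" and T: "T \<in> bounded_operators"
  shows "op_inverse (id_blinfun - z *\<^sub>C T) \<in> bounded_operators"
proof -
  let ?G = "blinfun_apply (op_inverse (id_blinfun - z *\<^sub>C T))"
  have "?G (c *\<^sub>C x) = c *\<^sub>C ?G x" for c x
  proof -
    have "c *\<^sub>C ?G x = ?G (c *\<^sub>C ?G x - z *\<^sub>C blinfun_apply T (c *\<^sub>C ?G x))"
      by (simp add: resolvent_apply(2)[OF z])
    also have "c *\<^sub>C ?G x - z *\<^sub>C blinfun_apply T (c *\<^sub>C ?G x)
        = c *\<^sub>C (?G x - z *\<^sub>C blinfun_apply T (?G x))"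
      by (simp add: bounded_operatorsD[OF T] complex_vector.scale_right_diff_distrib
          scaleC_scaleC mult.commute)
    also have "?G x - z *\<^sub>C blinfun_apply T (?G x) = x"
      using resolvent_apply(1)[OF z, of x] by (simp add: algebra_simps)
    finally show ?thesis
      by simp
  qed
  then show ?thesis
    by (simp add: bounded_operators_def)
qed

lemma one_plus_psi_transform:
  assumes "norm \<Omega> = 1" "z \<in> transform_disc T"
  shows "1 + psi_transform \<Omega> T z = vector_state \<Omega> (op_inverse (id_blinfun - z *\<^sub>C T))"
  using resolvent_apply(1)[OF assms(2), of \<Omega>] assms(1)
  by (metis (no_types, lifting) blinfun_apply_blinfun_compose cinner_add_right cinner_same of_real_1
      one_power2 psi_transform_def scaleC_blinfun.rep_eq vector_state_def)

lemma psi_transform_0: "psi_transform \<Omega> T 0 = 0"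
  by (simp add: psi_transform_def blinfun_simps)

text \<open>The Neumann series writes 1 + psi as the power series of the moments Phi(T^k), valid on
  the whole disc.\<close>

lemma psi_transform_holomorphic:
  assumes T: "T \<in> bounded_operators" and \<Omega>: "norm \<Omega> = 1"
  shows "psi_transform \<Omega> T holomorphic_on transform_disc T"
proof -
  define m where "m k = vector_state \<Omega> (op_power T k)" for k
  have sums: "(\<lambda>k. m k * (z - 0) ^ k) sums (1 + psi_transform \<Omega> T z)" if z: "z \<in> transform_disc T" for z
  proof -
    have "(\<lambda>k. vector_state \<Omega> (op_power (z *\<^sub>C T) k)) sums (1 + psi_transform \<Omega> T z)"
      unfolding one_plus_psi_transform[OF \<Omega> z]
      by (intro bounded_linear.sums[OF bounded_linear_vector_state] neumann_series norm_scaleC_less_one z)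
    then show ?thesis
      by (simp add: op_power_scaleC[OF T] m_def vector_state_def blinfun_simps cinner_scaleC_right mult.commute)
  qed
  \<comment> \<open>Power series are handled on balls; for \<open>T = 0\<close> the disc is the
    plane, and each point needs a ball of its own.\<close>
  have "\<exists>r. z \<in> ball 0 r \<and> ball 0 r \<subseteq> transform_disc T" if "z \<in> transform_disc T" for z
    using that by (cases "T = 0") (auto simp: transform_disc_eq_ball intro: exI[of _ "cmod z + 1"])
  moreover have "psi_transform \<Omega> T field_differentiable (at z within transform_disc T)"
    if z: "z \<in> ball 0 r" and sub: "ball 0 r \<subseteq> transform_disc T" for z r
  proof -
    have "(\<lambda>z. 1 + psi_transform \<Omega> T z) holomorphic_on ball 0 r"
      by (rule power_series_holomorphic[where a = m]) (use sub sums in auto)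
    from holomorphic_on_diff[OF this holomorphic_on_const[of 1]]
    have "psi_transform \<Omega> T holomorphic_on ball 0 r"
      by simp
    then have "psi_transform \<Omega> T field_differentiable (at z)"
      using z by (simp add: holomorphic_on_open field_differentiable_def)
    then show ?thesis
      by (rule field_differentiable_at_within)
  qed
  ultimately show ?thesis
    by (auto simp: holomorphic_on_def)
qed

text \<open>The extra factor \<open>T\<close> raises every power in the Neumann series by one, so
  the partial sums involve positive powers only. The free scalar \<open>w\<close> covers both zY(1 -
  zY)^-1 and U(1 - hU)^-1.\<close>

lemma resolvent_mult_in_closure_op_alg:
  assumes T: "T \<in> bounded_operators" and z: "z \<in> transform_disc T"
  shows "w *\<^sub>C (T o\<^sub>L op_inverse (id_blinfun - z *\<^sub>C T)) \<in> closure (op_alg T)"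
proof -
  let ?f = "\<lambda>S :: 'a \<Rightarrow>\<^sub>L 'a. w *\<^sub>C (T o\<^sub>L S)"
  have "bounded_linear (\<lambda>S :: 'a \<Rightarrow>\<^sub>L 'a. w *\<^sub>C S)"
    by (rule bounded_linear_intro[where K = "cmod w"])
      (simp_all add: scaleC_add_right scaleR_scaleC scaleC_scaleC mult.commute[of w]
        order.trans[OF norm_scaleC_blinfun_le] mult.commute[of "cmod w"])
  from bounded_linear_compose[OF this bounded_bilinear.bounded_linear_right[OF bounded_bilinear_blinfun_compose]]
  have lin: "bounded_linear ?f" .
  have "(\<lambda>k. ?f (op_power (z *\<^sub>C T) k)) sums ?f (op_inverse (id_blinfun - z *\<^sub>C T))"
    by (intro bounded_linear.sums[OF lin] neumann_series norm_scaleC_less_one z)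
  moreover have "?f (op_power (z *\<^sub>C T) k) = (w * z ^ k) *\<^sub>C op_power T (Suc k)" for k
    by (rule blinfun_eqI)
      (simp add: op_power_scaleC[OF T] op_power_Suc blinfun_simps bounded_operatorsD[OF T] scaleC_scaleC)
  ultimately have "(\<lambda>n. \<Sum>k<n. (w * z ^ k) *\<^sub>C op_power T (Suc k)) \<longlonglongrightarrow> ?f (op_inverse (id_blinfun - z *\<^sub>C T))"
    by (simp add: sums_def)
  moreover have "(\<Sum>k<n. (w * z ^ k) *\<^sub>C op_power T (Suc k)) \<in> op_alg T" for n
    unfolding op_alg_def
    by (intro complex_vector.span_sum complex_vector.span_scale complex_vector.span_base) auto
  ultimately show ?thesis
    by (rule LIMSEQ_in_closure[rotated])
qed

section \<open>Monotone independence\<close>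

lemma closure_subalgebra_compose:
  assumes A: "is_subalgebra A" and "S \<in> closure A" "T \<in> closure A"
  shows "S o\<^sub>L T \<in> closure A"
proof -
  obtain s t where "\<And>n. s n \<in> A" "s \<longlonglongrightarrow> S" "\<And>n. t n \<in> A" "t \<longlonglongrightarrow> T"
    using assms(2,3) unfolding closure_sequential by metis
  then have "(\<lambda>n. s n o\<^sub>L t n) \<longlonglongrightarrow> (S o\<^sub>L T)" "s n o\<^sub>L t n \<in> A" for n
    using A by (auto simp: is_subalgebra_def
        intro!: bounded_bilinear.tendsto[OF bounded_bilinear_blinfun_compose])
  then show ?thesis
    using LIMSEQ_in_closure[of "\<lambda>n. s n o\<^sub>L t n"] by blast
qed

lemma bounded_linear_scaleC_left: "bounded_linear (\<lambda>c. c *\<^sub>C x)"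
  for x :: "'a :: complex_hilbert_space"
  by (rule bounded_linear_intro[where K = "norm x"])
    (simp_all add: scaleC_add_left scaleR_scaleC scaleC_scaleC norm_scaleC scaleR_conv_of_real)

lemma eq_on_closure:
  fixes f g :: "'a :: topological_space \<Rightarrow> 'b :: t2_space"
  assumes "x \<in> closure S" "\<And>y. y \<in> S \<Longrightarrow> f y = g y" "continuous_on UNIV f" "continuous_on UNIV g"
  shows "f x = g x"
proof -
  have "closure S \<subseteq> {y. f y = g y}"
    using assms(2-4) by (intro closure_minimal closed_Collect_eq) auto
  then show ?thesis
    using assms(1) by auto
qed

text \<open>Both sides are continuous in each operator separately, so rule (a) extends one variable
  at a time: first \<open>H\<close>, then \<open>Q\<close>, then \<open>P\<close>.\<close>

lemma monotone_independent_closure_sandwich: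
  assumes mono: "monotone_independent_algebras \<Omega> A\<^sub>1 A\<^sub>2"
    and "P \<in> closure A\<^sub>1" "Q \<in> closure A\<^sub>1" "H \<in> closure A\<^sub>2"
  shows "blinfun_apply P (blinfun_apply H (blinfun_apply Q x)) =
    vector_state \<Omega> H *\<^sub>C blinfun_apply P (blinfun_apply Q x)"
proof -
  note ci = continuous_on_apply bounded_linear.continuous_on[OF blinfun.bounded_linear_right]
    bounded_linear.continuous_on[OF bounded_linear_scaleC]
    bounded_linear.continuous_on[OF bounded_linear_scaleC_left]
    bounded_linear.continuous_on[OF bounded_linear_vector_state] continuous_on_id
  have 1: "blinfun_apply P (blinfun_apply H (blinfun_apply Q x)) =
    vector_state \<Omega> H *\<^sub>C blinfun_apply P (blinfun_apply Q x)"
    if "P \<in> A\<^sub>1" "Q \<in> A\<^sub>1" "H \<in> A\<^sub>2" for P Q H x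
  proof -
    have "P o\<^sub>L H o\<^sub>L Q = vector_state \<Omega> H *\<^sub>C (P o\<^sub>L Q)"
      using mono that by (auto simp: monotone_independent_algebras_def)
    from arg_cong[OF this, of "\<lambda>S. blinfun_apply S x"] show ?thesis
      by (simp add: blinfun_simps)
  qed
  have 2: "blinfun_apply P (blinfun_apply H (blinfun_apply Q x)) =
    vector_state \<Omega> H *\<^sub>C blinfun_apply P (blinfun_apply Q x)"
    if "P \<in> A\<^sub>1" "Q \<in> A\<^sub>1" "H \<in> closure A\<^sub>2" for P Q H x
    using that(3) by (rule eq_on_closure) (use that 1 in \<open>auto intro!: ci\<close>)
  have 3: "blinfun_apply P (blinfun_apply H (blinfun_apply Q x)) =
    vector_state \<Omega> H *\<^sub>C blinfun_apply P (blinfun_apply Q x)"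
    if "P \<in> A\<^sub>1" "Q \<in> closure A\<^sub>1" "H \<in> closure A\<^sub>2" for P Q H x
    using that(2) by (rule eq_on_closure) (use that 2 in \<open>auto intro!: ci\<close>)
  show ?thesis
    using assms(2) by (rule eq_on_closure) (use assms 3 in \<open>auto intro!: ci\<close>)
qed

text \<open>Rule (b) extends in the same way, in the order \<open>K\<close>, \<open>H\<close>,
  \<open>P\<close>. Adjoining the identity commutes with taking closures because a singleton is
  closed.\<close>

lemma monotone_independent_closure_moment:
  assumes mono: "monotone_independent_algebras \<Omega> A\<^sub>1 A\<^sub>2"
    and P: "P \<in> closure A\<^sub>1"
    and H: "H \<in> closure A\<^sub>2 \<union> {id_blinfun}" and K: "K \<in> closure A\<^sub>2 \<union> {id_blinfun}"
  shows "vector_state \<Omega> (H o\<^sub>L P o\<^sub>L K) = vector_state \<Omega> H * vector_state \<Omega> P * vector_state \<Omega> K"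
proof -
  let ?A = "A\<^sub>2 \<union> {id_blinfun}"
  note ci = continuous_on_apply bounded_linear.continuous_on[OF blinfun.bounded_linear_right]
    bounded_linear.continuous_on[OF bounded_linear_vector_state] continuous_on_id
    continuous_on_const continuous_on_mult
    bounded_bilinear.continuous_on[OF bounded_bilinear_blinfun_compose]
  have 1: "vector_state \<Omega> (H o\<^sub>L P o\<^sub>L K) = vector_state \<Omega> H * vector_state \<Omega> P * vector_state \<Omega> K"
    if "P \<in> A\<^sub>1" "H \<in> ?A" "K \<in> ?A" for P H K
    using mono that unfolding monotone_independent_algebras_def by blast
  have 2: "vector_state \<Omega> (H o\<^sub>L P o\<^sub>L K) = vector_state \<Omega> H * vector_state \<Omega> P * vector_state \<Omega> K"
    if "P \<in> A\<^sub>1" "H \<in> ?A" "K \<in> closure ?A" for P H K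
    using that(3) by (rule eq_on_closure) (use that 1 in \<open>auto intro!: ci\<close>)
  have 3: "vector_state \<Omega> (H o\<^sub>L P o\<^sub>L K) = vector_state \<Omega> H * vector_state \<Omega> P * vector_state \<Omega> K"
    if "P \<in> A\<^sub>1" "H \<in> closure ?A" "K \<in> closure ?A" for P H K
    using that(2) by (rule eq_on_closure) (use that 2 in \<open>auto intro!: ci\<close>)
  have HK: "H \<in> closure ?A" "K \<in> closure ?A"
    using H K by (simp_all only: closure_Un closure_closed[OF closed_singleton])
  show ?thesis
    by (rule eq_on_closure[OF P]) (use HK 3 in \<open>auto intro!: ci\<close>)
qed

text \<open>The algebraic core at a single \<open>z\<close>: the disc hypotheses make the resolvents
  of A Y A, \<open>Y\<close>, X - 1 and \<open>X\<close> available through their Neumann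
  series.\<close>

lemma monotone_independent_resolvent_moment:
  fixes \<Omega> :: "'a :: complex_hilbert_space"
  assumes \<Omega>: "norm \<Omega> = 1"
    and X: "X \<in> bounded_operators" and Y: "Y \<in> bounded_operators" and A: "A \<in> bounded_operators"
    and sq: "A o\<^sub>L A = X"
    and A1: "A - id_blinfun \<in> closure (op_alg (X - id_blinfun))"
    and mono: "monotone_independent \<Omega> (X - id_blinfun) Y"
    and zS: "z \<in> transform_disc (A o\<^sub>L Y o\<^sub>L A)" and zY: "z \<in> transform_disc Y"
    and h: "h = psi_transform \<Omega> Y z" "h \<in> transform_disc (X - id_blinfun)" "1 + h \<noteq> 0"
    and w: "h / (1 + h) \<in> transform_disc X"
  shows "psi_transform \<Omega> (A o\<^sub>L Y o\<^sub>L A) z = psi_transform \<Omega> X (h / (1 + h))"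
proof -
  define U B where "U = X - id_blinfun" and "B = A - id_blinfun"
  define G where "G = op_inverse (id_blinfun - z *\<^sub>C Y)"
  define H where "H = z *\<^sub>C (Y o\<^sub>L G)"
  define V where "V = op_inverse (id_blinfun - h *\<^sub>C U)"
  define T where "T = U o\<^sub>L V"
  define S where "S = A o\<^sub>L Y o\<^sub>L A"
  let ?\<Phi> = "vector_state \<Omega>"
  have UB: "U \<in> bounded_operators"
    unfolding U_def by (intro bounded_operators_intros X)
  have hU: "h \<in> transform_disc U"
    using h(2) by (simp add: U_def)
  have VB: "V \<in> bounded_operators" and GB: "G \<in> bounded_operators"
    unfolding V_def G_def by (intro resolvent_bounded_operators hU UB zY Y)+
  have HB: "H \<in> bounded_operators"
    unfolding H_def by (intro bounded_operators_intros Y GB)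
  have BB: "B \<in> bounded_operators"
    unfolding B_def by (intro bounded_operators_intros A)
  note lin = bounded_operatorsD[OF BB] bounded_operatorsD[OF UB] bounded_operatorsD[OF VB] bounded_operatorsD[OF HB]
    bounded_operatorsD[OF A] bounded_operatorsD[OF Y] bounded_operatorsD[OF X]

  have memB: "B \<in> closure (op_alg U)"
    using A1 by (simp add: B_def U_def)
  have memT: "T \<in> closure (op_alg U)"
    using resolvent_mult_in_closure_op_alg[OF UB hU, of 1] by (simp add: T_def V_def)
  \<comment> \<open>At parameter 0 the resolvent is the identity, so the closure lemma returns
    \<open>U\<close> itself.\<close>
  have memU: "U \<in> closure (op_alg U)"
    using resolvent_mult_in_closure_op_alg[OF UB zero_in_transform_disc, of 1]
      neumann_series(2)[of "0 :: 'a \<Rightarrow>\<^sub>L 'a"] by simp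
  have memH: "H \<in> closure (op_alg Y)"
    unfolding H_def G_def by (rule resolvent_mult_in_closure_op_alg[OF Y zY])
  note mult = closure_subalgebra_compose[OF is_subalgebra_op_alg[OF UB]]
  have mono': "monotone_independent_algebras \<Omega> (op_alg U) (op_alg Y)"
    using mono by (simp add: monotone_independent_def U_def)
  have \<Phi>H: "?\<Phi> H = h"
    by (simp add: h(1) H_def G_def vector_state_def psi_transform_def blinfun_simps)
  have \<Phi>1: "?\<Phi> id_blinfun = 1"
    using \<Omega> by (simp add: vector_state_def cinner_same)
  have sandwich: "blinfun_apply P (blinfun_apply H (blinfun_apply Q x)) = h *\<^sub>C blinfun_apply P (blinfun_apply Q x)"
    if "P \<in> closure (op_alg U)" "Q \<in> closure (op_alg U)" for P Q x
    using monotone_independent_closure_sandwich[OF mono' that memH] by (simp add: \<Phi>H)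
  have moment: "?\<Phi> (H o\<^sub>L P) = h * ?\<Phi> P" "?\<Phi> (P o\<^sub>L H) = h * ?\<Phi> P" "?\<Phi> (H o\<^sub>L P o\<^sub>L H) = h\<^sup>2 * ?\<Phi> P"
    if "P \<in> closure (op_alg U)" for P
    using monotone_independent_closure_moment[OF mono' that, of H id_blinfun]
      monotone_independent_closure_moment[OF mono' that, of id_blinfun H]
      monotone_independent_closure_moment[OF mono' that, of H H] memH
    by (simp_all add: \<Phi>H \<Phi>1 power2_eq_square)

  \<comment> \<open>Since 1 + H is the resolvent \<open>G\<close>, this is H = zY(1 + H).\<close>
  have Hrec: "blinfun_apply H v = z *\<^sub>C blinfun_apply Y (v + blinfun_apply H v)" for v
    using resolvent_apply(1)[OF zY, of v] by (simp add: H_def G_def blinfun_simps)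
  have Vrec: "blinfun_apply V v = v + h *\<^sub>C blinfun_apply U (blinfun_apply V v)" for v
    unfolding V_def by (rule resolvent_apply(1)[OF hU])
  have V_inv: "blinfun_apply V v - h *\<^sub>C blinfun_apply U (blinfun_apply V v) = v" for v
    using Vrec[of v] by (simp only: diff_eq_eq)
  have AA: "blinfun_apply A (blinfun_apply A v) = v + blinfun_apply U v" for v
    using arg_cong[OF sq, of "\<lambda>S. blinfun_apply S v"] by (simp add: U_def blinfun_simps)
  \<comment> \<open>Compute A^3 in two ways from A^2 = 1 + U.\<close>
  have AU: "blinfun_apply A (blinfun_apply U v) = blinfun_apply U (blinfun_apply A v)" for v
    using AA[of "blinfun_apply A v"] by (simp add: AA blinfun_simps)
  have AV: "blinfun_apply A (blinfun_apply V v) = blinfun_apply V (blinfun_apply A v)" for v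
  proof -
    have "blinfun_apply V (blinfun_apply A v) =
        blinfun_apply V (blinfun_apply A (blinfun_apply V v - h *\<^sub>C blinfun_apply U (blinfun_apply V v)))"
      by (simp only: V_inv)
    also have "\<dots> = blinfun_apply V (blinfun_apply A (blinfun_apply V v) -
        h *\<^sub>C blinfun_apply U (blinfun_apply A (blinfun_apply V v)))"
      by (simp add: blinfun_simps lin AU)
    also have "\<dots> = blinfun_apply A (blinfun_apply V v)"
      unfolding V_def by (rule resolvent_apply(2)[OF hU])
    finally show ?thesis
      by simp
  qed

  have resolvent_S: "blinfun_apply (op_inverse (id_blinfun - z *\<^sub>C S)) \<Omega> =
      \<Omega> + blinfun_apply A (blinfun_apply H (blinfun_apply A \<Omega> + blinfun_apply T (blinfun_apply H (blinfun_apply A \<Omega>))))"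
  proof -
    \<comment> \<open>The claimed value \<open>?J\<close> is verified by substitution. The vector
      \<open>q\<close> satisfies A J = q + H q, after which the recursion for \<open>H\<close> gives
      z S J = A H q = J - \<Omega>.\<close>
    define y q where "y = blinfun_apply A \<Omega>" and "q = y + blinfun_apply T (blinfun_apply H y)"
    let ?J = "\<Omega> + blinfun_apply A (blinfun_apply H q)"
    \<comment> \<open>The sandwich rule U H U = h U^2 exposes the recursion of \<open>V\<close>: U(1
      + hUV)Hy = U V H y = T H y.\<close>
    have "blinfun_apply U (blinfun_apply H q)
        = blinfun_apply U (blinfun_apply H y + h *\<^sub>C blinfun_apply U (blinfun_apply V (blinfun_apply H y)))"
      by (simp add: q_def T_def blinfun_simps sandwich[OF memU memU] lin)
    also have "\<dots> = blinfun_apply T (blinfun_apply H y)"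
      by (simp only: T_def blinfun_apply_blinfun_compose Vrec[of "blinfun_apply H y", symmetric])
    finally have "blinfun_apply A ?J = q + blinfun_apply H q"
      by (simp add: blinfun_simps AA q_def y_def)
    then have "blinfun_apply S ?J = blinfun_apply A (blinfun_apply Y (q + blinfun_apply H q))"
      by (simp only: S_def blinfun_apply_blinfun_compose)
    moreover have "blinfun_apply A (blinfun_apply H q) =
        z *\<^sub>C blinfun_apply A (blinfun_apply Y (q + blinfun_apply H q))"
      using arg_cong[OF Hrec[of q], of "blinfun_apply A"] by (simp only: bounded_operatorsD[OF A])
    ultimately have "z *\<^sub>C blinfun_apply S ?J = blinfun_apply A (blinfun_apply H q)"
      by (simp only:)
    then have "?J - z *\<^sub>C blinfun_apply S ?J = \<Omega>"
      by simp
    then have "blinfun_apply (op_inverse (id_blinfun - z *\<^sub>C S)) \<Omega> = ?J"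
      using resolvent_apply(2)[of z S ?J] zS by (simp add: S_def)
    then show ?thesis
      by (simp add: q_def y_def)
  qed

  have Adec: "blinfun_apply A v = v + blinfun_apply B v" for v
    by (simp add: B_def blinfun_simps)
  \<comment> \<open>Expand A = 1 + B. The sandwich rule handles B H B and the moment rule the mixed
    terms; all four terms acquire the same factor \<open>h\<close>, so they recombine to h
    Phi(A^2).\<close>
  have AHA: "?\<Phi> (A o\<^sub>L H o\<^sub>L A) = h * ?\<Phi> X"
  proof -
    have "?\<Phi> (A o\<^sub>L H o\<^sub>L A) = ?\<Phi> H + ?\<Phi> (H o\<^sub>L B) + ?\<Phi> (B o\<^sub>L H) + h * ?\<Phi> (B o\<^sub>L B)"
      by (simp add: vector_state_def Adec blinfun_simps sandwich[OF memB memB] cinner_add_right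
          cinner_scaleC_right)
    also have "\<dots> = h * (?\<Phi> id_blinfun + ?\<Phi> B + ?\<Phi> B + ?\<Phi> (B o\<^sub>L B))"
      by (simp add: \<Phi>H \<Phi>1 moment[OF memB] algebra_simps)
    also have "?\<Phi> id_blinfun + ?\<Phi> B + ?\<Phi> B + ?\<Phi> (B o\<^sub>L B) = ?\<Phi> (A o\<^sub>L A)"
      by (simp add: vector_state_def Adec blinfun_simps cinner_add_right)
    finally show ?thesis
      by (simp add: sq)
  qed
  \<comment> \<open>Each of the two \<open>H\<close> contributes a factor \<open>h\<close>: by the
    sandwich rule when it stands between closure elements, by the moment rule when it stands at an
    end. What remains is A T A, which is X T because \<open>A\<close> commutes with \<open>U\<close>
    and \<open>V\<close>.\<close>
  have AHTHA: "?\<Phi> (A o\<^sub>L H o\<^sub>L T o\<^sub>L H o\<^sub>L A) = h\<^sup>2 * ?\<Phi> (X o\<^sub>L T)"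
  proof -
    have "?\<Phi> (A o\<^sub>L H o\<^sub>L T o\<^sub>L H o\<^sub>L A) =
        ?\<Phi> (H o\<^sub>L T o\<^sub>L H) + h * ?\<Phi> (H o\<^sub>L (T o\<^sub>L B)) + h * ?\<Phi> ((B o\<^sub>L T) o\<^sub>L H) + h\<^sup>2 * ?\<Phi> (B o\<^sub>L T o\<^sub>L B)"
      by (simp add: vector_state_def Adec blinfun_simps sandwich[OF memB memT] sandwich[OF memT memB]
          lin cinner_add_right cinner_scaleC_right power2_eq_square)
    also have "\<dots> = h\<^sup>2 * (?\<Phi> T + ?\<Phi> (T o\<^sub>L B) + ?\<Phi> (B o\<^sub>L T) + ?\<Phi> (B o\<^sub>L T o\<^sub>L B))"
      by (simp add: moment[OF memT] moment[OF mult[OF memT memB]] moment[OF mult[OF memB memT]]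
          algebra_simps power2_eq_square)
    also have "?\<Phi> T + ?\<Phi> (T o\<^sub>L B) + ?\<Phi> (B o\<^sub>L T) + ?\<Phi> (B o\<^sub>L T o\<^sub>L B) = ?\<Phi> (A o\<^sub>L T o\<^sub>L A)"
      by (simp add: vector_state_def Adec blinfun_simps cinner_add_right)
    also have "A o\<^sub>L T o\<^sub>L A = X o\<^sub>L T"
      by (rule blinfun_eqI) (simp add: T_def AU AV flip: sq)
    finally show ?thesis .
  qed

  have "1 + psi_transform \<Omega> S z = ?\<Phi> id_blinfun + ?\<Phi> (A o\<^sub>L H o\<^sub>L A) + ?\<Phi> (A o\<^sub>L H o\<^sub>L T o\<^sub>L H o\<^sub>L A)"
    using one_plus_psi_transform[OF \<Omega> zS] resolvent_S
    by (simp add: S_def vector_state_def blinfun_simps cinner_add_right)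
  also have "\<dots> = 1 + h * ?\<Phi> (X o\<^sub>L V)"
  proof -
    have "?\<Phi> (X o\<^sub>L V) = ?\<Phi> X + h * ?\<Phi> (X o\<^sub>L T)"
      by (simp add: vector_state_def T_def lin cinner_add_right cinner_scaleC_right blinfun_simps
          arg_cong[OF Vrec[of \<Omega>], of "blinfun_apply X"])
    then show ?thesis
      by (simp add: \<Phi>1 AHA AHTHA power2_eq_square algebra_simps)
  qed
  also have "\<dots> = (1 + h) * ?\<Phi> V"
  proof -
    \<comment> \<open>With X = 1 + U this replaces h Phi(UV) by Phi(V) - 1.\<close>
    have "?\<Phi> V = 1 + h * ?\<Phi> (U o\<^sub>L V)"
      using arg_cong[OF Vrec[of \<Omega>], of "cinner \<Omega>"] \<Phi>1
      by (simp add: vector_state_def cinner_add_right cinner_scaleC_right)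
    moreover have "?\<Phi> (X o\<^sub>L V) = ?\<Phi> V + ?\<Phi> (U o\<^sub>L V)"
      by (simp add: vector_state_def U_def blinfun_simps cinner_diff_right)
    ultimately show ?thesis
      by (simp add: algebra_simps)
  qed
  also have "\<dots> = 1 + psi_transform \<Omega> X (h / (1 + h))"
  proof -
    let ?w = "h / (1 + h)"
    \<comment> \<open>The factor 1 + h compensates the denominator in 1 - wX = (1 - hU)/(1 +
      h).\<close>
    let ?v = "(1 + h) *\<^sub>C blinfun_apply V \<Omega>"
    have "blinfun_apply X (blinfun_apply V \<Omega>) = blinfun_apply V \<Omega> + blinfun_apply U (blinfun_apply V \<Omega>)"
      by (simp add: U_def blinfun_simps)
    then have "?v - ?w *\<^sub>C blinfun_apply X ?v =
        (1 + h) *\<^sub>C blinfun_apply V \<Omega> - h *\<^sub>C (blinfun_apply V \<Omega> + blinfun_apply U (blinfun_apply V \<Omega>))"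
      using h(3) by (simp add: lin scaleC_scaleC)
    also have "\<dots> = blinfun_apply V \<Omega> - h *\<^sub>C blinfun_apply U (blinfun_apply V \<Omega>)"
      by (simp add: scaleC_add_left scaleC_add_right)
    also have "\<dots> = \<Omega>"
      by (rule V_inv)
    finally have "blinfun_apply (op_inverse (id_blinfun - ?w *\<^sub>C X)) \<Omega> = ?v"
      using resolvent_apply(2)[OF w, of ?v] by simp
    then show ?thesis
      by (simp add: one_plus_psi_transform[OF \<Omega> w] vector_state_def cinner_scaleC_right)
  qed
  finally show ?thesis
    by (simp add: S_def)
qed

section \<open>From a neighbourhood of 0 to the whole disc\<close>

theorem corollary4p3:
  fixes \<Omega> :: "'h :: complex_hilbert_space"
    and X Y :: "'h \<Rightarrow>\<^sub>L 'h"
  assumes "norm \<Omega> = 1"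
    and "positive_operator X"
    and "positive_operator Y"
    and "monotone_independent \<Omega> (X - id_blinfun) Y"
  shows
    "let S = op_sqrt X o\<^sub>L Y o\<^sub>L op_sqrt X;
         D = {z. ereal (cmod z) < min (1 / ereal (norm S)) (1 / ereal (norm Y))};
         F = (\<lambda>z. K_transform \<Omega> X (K_transform \<Omega> Y z))
     in (\<forall>\<^sub>F z in nhds 0.
           z \<in> transform_disc Y \<and> 1 + psi_transform \<Omega> Y z \<noteq> 0 \<and>
           K_transform \<Omega> Y z \<in> transform_disc X \<and>
           1 + psi_transform \<Omega> X (K_transform \<Omega> Y z) \<noteq> 0) \<and>
        F analytic_on {0} \<and>
        (\<exists>G. meromorphic_continuation_from_0 F D G) \<and>
        (\<forall>G. meromorphic_continuation_from_0 F D G \<longrightarrow>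
              (\<forall>z\<in>D. K_transform \<Omega> S z = G z))"
proof -
  define A S where "A = op_sqrt X" and "S = A o\<^sub>L Y o\<^sub>L A"
  define D where "D = transform_disc S \<inter> transform_disc Y"
  define F where "F = (\<lambda>z. K_transform \<Omega> X (K_transform \<Omega> Y z))"
  note A = op_sqrt_properties[OF assms(2), folded A_def]
  have XB: "X \<in> bounded_operators" and YB: "Y \<in> bounded_operators" and AB: "A \<in> bounded_operators"
    using assms(2,3) A(1) by (auto simp: positive_operator_def)
  have SB: "S \<in> bounded_operators"
    unfolding S_def by (intro bounded_operators_intros AB YB)
  \<comment> \<open>The minimum of the radii is an intersection of two convex discs, so the identity
    theorem applies on \<open>D\<close>.\<close>
  have D: "open D" "connected D" "0 \<in> D"
    unfolding D_def
    by (auto intro!: open_Int open_transform_disc convex_connected convex_Int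
        convex_transform_disc zero_in_transform_disc)
  have analytic: "psi_transform \<Omega> T analytic_on {0}" if "T \<in> bounded_operators" for T
    using psi_transform_holomorphic[OF that assms(1)] open_transform_disc zero_in_transform_disc
    by (auto simp: analytic_at)
  have K_analytic: "K_transform \<Omega> T analytic_on {0}" if "T \<in> bounded_operators" for T
    unfolding K_transform_def[abs_def]
    by (intro analytic_intros analytic that) (simp add: psi_transform_0)
  have K0: "K_transform \<Omega> T 0 = 0" for T
    by (simp add: K_transform_def psi_transform_0)
  have lim_psi: "(psi_transform \<Omega> T \<longlongrightarrow> 0) (nhds 0)" if "T \<in> bounded_operators" for T
    using analytic_at_imp_isCont[OF analytic[OF that]]
      tendsto_at_iff_tendsto_nhds[of "psi_transform \<Omega> T" 0]
    by (simp add: isCont_def psi_transform_0)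
  have lim_K: "(K_transform \<Omega> Y \<longlongrightarrow> 0) (nhds 0)"
    using analytic_at_imp_isCont[OF K_analytic[OF YB]]
      tendsto_at_iff_tendsto_nhds[of "K_transform \<Omega> Y" 0]
    by (simp add: isCont_def K0)
  have ev_disc: "\<forall>\<^sub>F z in nhds 0. f z \<in> transform_disc T"
    if "(f \<longlongrightarrow> 0) (nhds (0 :: complex))" for f :: "complex \<Rightarrow> complex" and T :: "'h \<Rightarrow>\<^sub>L 'h"
    using that open_transform_disc zero_in_transform_disc by (rule topological_tendstoD)
  have ev_ne: "\<forall>\<^sub>F z in nhds 0. 1 + f z \<noteq> 0"
    if "(f \<longlongrightarrow> 0) (nhds (0 :: complex))" for f :: "complex \<Rightarrow> complex"
    using topological_tendstoD[OF that, of "- {-1}"]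
    by (auto simp: open_Compl add_eq_0_iff elim: eventually_mono)
  \<comment> \<open>All inner transforms tend to 0 with \<open>z\<close>, so every nondegeneracy
    condition holds near 0. This serves both the moment identity and the claim that the composition
    is defined there.\<close>
  have near_0: "\<forall>\<^sub>F z in nhds 0. z \<in> D \<and> psi_transform \<Omega> Y z \<in> transform_disc (X - id_blinfun) \<and>
      1 + psi_transform \<Omega> Y z \<noteq> 0 \<and> K_transform \<Omega> Y z \<in> transform_disc X \<and>
      1 + psi_transform \<Omega> X (K_transform \<Omega> Y z) \<noteq> 0"
    using D(1,3)
    by (intro eventually_conj eventually_nhds_in_open ev_disc ev_ne lim_psi lim_K YB
        filterlim_compose[OF lim_psi[OF XB]])
  have eq: "\<forall>\<^sub>F z in nhds 0. K_transform \<Omega> S z = F z"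
    using near_0
  proof eventually_elim
    case (elim z)
    have "psi_transform \<Omega> S z = psi_transform \<Omega> X (K_transform \<Omega> Y z)"
      unfolding S_def K_transform_def
      by (rule monotone_independent_resolvent_moment[OF assms(1) XB YB AB A(2,3) assms(4)])
        (use elim in \<open>auto simp: D_def S_def K_transform_def\<close>)
    then show ?case
      by (simp add: F_def K_transform_def)
  qed
  \<comment> \<open>The left-hand side is itself the continuation, which settles existence. The base
    point is 0, where psi vanishes and the denominator is 1.\<close>
  have K_mero: "K_transform \<Omega> S nicely_meromorphic_on D"
    unfolding K_transform_def[abs_def]
    by (rule nicely_meromorphic_on_divide_one_plus[OF _ D])
      (auto simp: psi_transform_0 D_def
        intro: holomorphic_on_subset[OF psi_transform_holomorphic[OF SB assms(1)]])
  have cont: "meromorphic_continuation_from_0 F D (K_transform \<Omega> S)"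
    using K_mero eq by (simp add: meromorphic_continuation_from_0_def)
  have unique: "K_transform \<Omega> S z = G z" if G: "meromorphic_continuation_from_0 F D G" and z: "z \<in> D" for G z
  proof (rule nicely_meromorphic_on_eqI[OF K_mero _ D _ z])
    show "G nicely_meromorphic_on D"
      using G by (simp add: meromorphic_continuation_from_0_def)
    have "\<forall>\<^sub>F z in nhds 0. G z = F z"
      using G by (simp add: meromorphic_continuation_from_0_def)
    with eq show "\<forall>\<^sub>F z in nhds 0. K_transform \<Omega> S z = G z"
      by eventually_elim simp
  qed
  have "F analytic_on {0}"
    unfolding F_def using analytic_on_compose[OF K_analytic[OF YB], of "K_transform \<Omega> X"] K_analytic[OF XB]
    by (simp add: K0 o_def)
  moreover have "D = {z. ereal (cmod z) < min (1 / ereal (norm S)) (1 / ereal (norm Y))}"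
    by (auto simp: D_def transform_disc_def)
  moreover have "\<forall>\<^sub>F z in nhds 0.
           z \<in> transform_disc Y \<and> 1 + psi_transform \<Omega> Y z \<noteq> 0 \<and>
           K_transform \<Omega> Y z \<in> transform_disc X \<and>
           1 + psi_transform \<Omega> X (K_transform \<Omega> Y z) \<noteq> 0"
    using near_0 by eventually_elim (simp add: D_def)
  ultimately show ?thesis
    using cont unique unfolding Let_def S_def[symmetric] A_def[symmetric] F_def[symmetric]
    by (auto simp: S_def A_def F_def)
qed

end
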